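(* Let $(W,S)$ be a universal Coxeter system of finite rank at least $2$. Then there exists an RGD-system of type $(W,S)$ over $\mathbb{F}_2$ which does not satisfy property (FPRS).
   Context: A Coxeter system $(W,S)$ is universal if $st$ has infinite order for all $s\neq t\in S$; its rank is $|S|$. **Roots.** Let $\ell$ be the length function. For $s\in S$ put $\alpha_s=\{w\in W\mid \ell(sw)>\ell(w)\}$. A root is a subset $v\alpha_s\subseteq W$ ($v\in W$, $s\in S$); $\Phi$ is the set of roots, $W$ acts on it by left multiplication, $-\alpha=W\setminus\alpha$, $\Phi_+=\{\alpha\in\Phi\mid 1_W\in\alpha\}$. A pair $\{\alpha,\beta\}$ of roots is prenilpotent if $\alpha\cap\beta\neq\emptyset\neq(-\alpha)\cap(-\beta)$; then $[\alpha,\beta]=\{\gamma\in\Phi\mid\alpha\cap\beta\subseteq\gamma,\ (-\alpha)\cap(-\beta)\subseteq-\gamma\}$ and $(\alpha,\beta)=[\alpha,\beta]\setminus\{\alpha,\beta\}$. **RGD-systems.** An RGD-system of type $(W,S)$ is a pair $(G,(U_\alpha)_{\alpha\in\Phi})$ of a group and subgroups (root groups) such that, with $H=\bigcap_{\alpha\in\Phi}N_G(U_\alpha)$ and $U_+=\langle U_\alpha\mid\alpha\in\Phi_+\rangle$: (RGD0) all $U_\alpha\neq\{1\}$; (RGD1) $[U_\alpha,U_\beta]\leq\langle U_\gamma\mid\gamma\in(\alpha,\beta)\rangle$ for every prenilpotent pair $\{\alpha,\beta\}$, $\alpha\neq\beta$; (RGD2) for each $s\in S$, $u\in U_{\alpha_s}\setminus\{1\}$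 there are $u',u''\in U_{-\alpha_s}$ such that $m(u):=u'uu''$ conjugates $U_\beta$ onto $U_{s\beta}$ for each $\beta\in\Phi$; (RGD3) $U_{-\alpha_s}\not\leq U_+$ for each $s\in S$; (RGD4) $G=H\langle U_\alpha\mid\alpha\in\Phi\rangle$. It is over $\mathbb{F}_2$ if every root group has order $2$. **The associated building.** Let $B_+=HU_+$ and $N=\langle H,\ m(u)\mid s\in S,\ u\in U_{\alpha_s}\setminus\{1\}\rangle$; then $N/H\cong W$ with $m(u)H\mapsto s$ for $u\in U_{\alpha_s}\setminus\{1\}$. The positive building of the RGD-system has chamber set $G/B_+$, with $\delta(gB_+,hB_+)=w$ iff $g^{-1}h\in B_+nB_+$, where $n\in N$ represents $w$; $G$ acts by left multiplication. Put $c_+=B_+$ and, for $r\in\mathbb{N}$, let $B(c_+,r)$ be the ball of all chambers $c$ with $\ell(\delta(c_+,c))\leq r$. **Property (FPRS)** (Caprace–Rémy). For $\alpha\in\Phi$ let $\ell(1_W,-\alpha)=\min\{\ell(v)\mid v\in-\alpha\}$. The RGD-system satisfies (FPRS) if for every sequence of roots $(\alpha_n)_{n\in\mathbb{N}}$ with $\lim_{n\to\infty}\ell(1_W,-\alpha_n)=\infty$ and every $r\in\mathbb{N}$ there is $n_0$ such that for all $n\geq n_0$ the root group $U_{\alpha_n}$ fixes $B(c_+,r)$ pointwise. *)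

theory Defs
  imports Complex_Main "HOL-Algebra.Algebra"
begin

section \<open>Coxeter systems\<close>

definition word_val :: "('a, 'b) monoid_scheme \<Rightarrow> 'a list \<Rightarrow> 'a" where
  "word_val W ws = foldr (\<lambda>x y. x \<otimes>\<^bsub>W\<^esub> y) ws \<one>\<^bsub>W\<^esub>"

text \<open>Deletion of a relator \<open>(st)\<^sup>m\<close>, where \<open>m\<close> is the order of \<open>st\<close> in \<open>W\<close>. For \<open>s = t\<close> this
  deletes \<open>ss\<close>. If \<open>st\<close> has infinite order, then \<open>group.ord\<close> is \<open>0\<close> and nothing is deleted.\<close>

definition coxeter_step :: "('a, 'b) monoid_scheme \<Rightarrow> 'a set \<Rightarrow> 'a list \<Rightarrow> 'a list \<Rightarrow> bool" where
  "coxeter_step W S us vs \<longleftrightarrow>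
     (\<exists>xs\<in>lists S. \<exists>ys\<in>lists S. \<exists>s\<in>S. \<exists>t\<in>S.
        us = xs @ concat (replicate (group.ord W (s \<otimes>\<^bsub>W\<^esub> t)) [s, t]) @ ys \<and> vs = xs @ ys)"

text \<open>\<open>W\<close> has the presentation with generators \<open>S\<close> and relations \<open>(st)\<^sup>m = 1\<close> for \<open>s, t\<close> in \<open>S\<close>
  with \<open>st\<close> of finite order \<open>m\<close>. Formal inverses of generators are not needed, because the
  relators include \<open>ss\<close>.\<close>

definition coxeter_system :: "('a, 'b) monoid_scheme \<Rightarrow> 'a set \<Rightarrow> bool" where
  "coxeter_system W S \<longleftrightarrow>
     group W \<and> S \<subseteq> carrier W \<and> generate W S = carrier W \<and>
     (\<forall>s\<in>S. group.ord W s = 2) \<and>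
     (\<forall>us\<in>lists S. \<forall>vs\<in>lists S.
        word_val W us = word_val W vs \<longleftrightarrow> equivclp (coxeter_step W S) us vs)"

definition universal_coxeter_system :: "('a, 'b) monoid_scheme \<Rightarrow> 'a set \<Rightarrow> bool" where
  "universal_coxeter_system W S \<longleftrightarrow>
     coxeter_system W S \<and> (\<forall>s\<in>S. \<forall>t\<in>S. s \<noteq> t \<longrightarrow> group.ord W (s \<otimes>\<^bsub>W\<^esub> t) = 0)"

definition cox_length :: "('a, 'b) monoid_scheme \<Rightarrow> 'a set \<Rightarrow> 'a \<Rightarrow> nat" where
  "cox_length W S w = (LEAST n. \<exists>ws\<in>lists S. length ws = n \<and> word_val W ws = w)"


section \<open>Roots\<close>

definition simple_root :: "('a, 'b) monoid_scheme \<Rightarrow> 'a set \<Rightarrow> 'a \<Rightarrow> 'a set" where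
  "simple_root W S s = {w \<in> carrier W. cox_length W S (s \<otimes>\<^bsub>W\<^esub> w) > cox_length W S w}"

definition roots :: "('a, 'b) monoid_scheme \<Rightarrow> 'a set \<Rightarrow> 'a set set" where
  "roots W S = {v <#\<^bsub>W\<^esub> simple_root W S s | v s. v \<in> carrier W \<and> s \<in> S}"

definition opp :: "('a, 'b) monoid_scheme \<Rightarrow> 'a set \<Rightarrow> 'a set" where
  "opp W \<alpha> = carrier W - \<alpha>"

definition pos_roots :: "('a, 'b) monoid_scheme \<Rightarrow> 'a set \<Rightarrow> 'a set set" where
  "pos_roots W S = {\<alpha> \<in> roots W S. \<one>\<^bsub>W\<^esub> \<in> \<alpha>}"

definition prenilpotent :: "('a, 'b) monoid_scheme \<Rightarrow> 'a set \<Rightarrow> 'a set \<Rightarrow> bool" where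
  "prenilpotent W \<alpha> \<beta> \<longleftrightarrow> \<alpha> \<inter> \<beta> \<noteq> {} \<and> opp W \<alpha> \<inter> opp W \<beta> \<noteq> {}"

definition closed_root_interval ::
  "('a, 'b) monoid_scheme \<Rightarrow> 'a set \<Rightarrow> 'a set \<Rightarrow> 'a set \<Rightarrow> 'a set set" where
  "closed_root_interval W S \<alpha> \<beta> =
     {\<gamma> \<in> roots W S. \<alpha> \<inter> \<beta> \<subseteq> \<gamma> \<and> opp W \<alpha> \<inter> opp W \<beta> \<subseteq> opp W \<gamma>}"

definition open_root_interval ::
  "('a, 'b) monoid_scheme \<Rightarrow> 'a set \<Rightarrow> 'a set \<Rightarrow> 'a set \<Rightarrow> 'a set set" where
  "open_root_interval W S \<alpha> \<beta> = closed_root_interval W S \<alpha> \<beta> - {\<alpha>, \<beta>}"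

text \<open>The minimum of \<open>cox_length\<close> over \<open>opp W \<alpha>\<close>: \<open>Inf\<close> of a nonempty set of naturals is attained,
  whereas \<open>Min\<close> would require the set to be finite.\<close>

definition root_depth :: "('a, 'b) monoid_scheme \<Rightarrow> 'a set \<Rightarrow> 'a set \<Rightarrow> nat" where
  "root_depth W S \<alpha> = Inf (cox_length W S ` opp W \<alpha>)"


section \<open>RGD-systems\<close>

definition rgd_H ::
  "('a, 'b) monoid_scheme \<Rightarrow> 'a set \<Rightarrow> ('g, 'h) monoid_scheme \<Rightarrow> ('a set \<Rightarrow> 'g set) \<Rightarrow> 'g set" where
  "rgd_H W S G U = {g \<in> carrier G. \<forall>\<alpha>\<in>roots W S. g \<in> normalizer G (U \<alpha>)}"

definition rgd_U_plus ::
  "('a, 'b) monoid_scheme \<Rightarrow> 'a set \<Rightarrow> ('g, 'h) monoid_scheme \<Rightarrow> ('a set \<Rightarrow> 'g set) \<Rightarrow> 'g set" where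
  "rgd_U_plus W S G U = generate G (\<Union>\<alpha>\<in>pos_roots W S. U \<alpha>)"

definition commutator_group :: "('g, 'h) monoid_scheme \<Rightarrow> 'g set \<Rightarrow> 'g set \<Rightarrow> 'g set" where
  "commutator_group G A B =
     generate G {x \<otimes>\<^bsub>G\<^esub> y \<otimes>\<^bsub>G\<^esub> inv\<^bsub>G\<^esub> x \<otimes>\<^bsub>G\<^esub> inv\<^bsub>G\<^esub> y | x y. x \<in> A \<and> y \<in> B}"

text \<open>\<open>is_m W S G U s u m\<close> says that \<open>m\<close> is a possible value of \<open>m(u)\<close>. Two possible values for the
  same \<open>u\<close> differ by an element of \<open>rgd_H\<close>, so the group \<open>rgd_N\<close> below, which contains \<open>rgd_H\<close>, and
  the coset of \<open>m(u)\<close> do not depend on a choice.\<close>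

definition is_m ::
  "('a, 'b) monoid_scheme \<Rightarrow> 'a set \<Rightarrow> ('g, 'h) monoid_scheme \<Rightarrow> ('a set \<Rightarrow> 'g set) \<Rightarrow>
     'a \<Rightarrow> 'g \<Rightarrow> 'g \<Rightarrow> bool" where
  "is_m W S G U s u m \<longleftrightarrow>
     (\<exists>u'\<in>U (opp W (simple_root W S s)). \<exists>u''\<in>U (opp W (simple_root W S s)).
        m = u' \<otimes>\<^bsub>G\<^esub> u \<otimes>\<^bsub>G\<^esub> u'') \<and>
     (\<forall>\<beta>\<in>roots W S. m <#\<^bsub>G\<^esub> U \<beta> #>\<^bsub>G\<^esub> inv\<^bsub>G\<^esub> m = U (s <#\<^bsub>W\<^esub> \<beta>))"

text \<open>Only the values of \<open>U\<close> on \<open>roots W S\<close> matter. If \<open>S\<close> is finite and all root groups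
  have order 2, then they generate a countable subgroup of \<open>G\<close>, which together with \<open>U\<close> is again an
  RGD-system, with the same positive building. So the existence of such systems may be stated for
  groups whose carrier consists of natural numbers.\<close>

definition RGD_system ::
  "('a, 'b) monoid_scheme \<Rightarrow> 'a set \<Rightarrow> ('g, 'h) monoid_scheme \<Rightarrow> ('a set \<Rightarrow> 'g set) \<Rightarrow> bool" where
  "RGD_system W S G U \<longleftrightarrow>
     group G \<and>
     (\<forall>\<alpha>\<in>roots W S. subgroup (U \<alpha>) G) \<and>
     (\<forall>\<alpha>\<in>roots W S. U \<alpha> \<noteq> {\<one>\<^bsub>G\<^esub>}) \<and>
     (\<forall>\<alpha>\<in>roots W S. \<forall>\<beta>\<in>roots W S. prenilpotent W \<alpha> \<beta> \<and> \<alpha> \<noteq> \<beta> \<longrightarrow>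
        commutator_group G (U \<alpha>) (U \<beta>) \<subseteq> generate G (\<Union>\<gamma>\<in>open_root_interval W S \<alpha> \<beta>. U \<gamma>)) \<and>
     (\<forall>s\<in>S. \<forall>u\<in>U (simple_root W S s) - {\<one>\<^bsub>G\<^esub>}. \<exists>m. is_m W S G U s u m) \<and>
     (\<forall>s\<in>S. \<not> U (opp W (simple_root W S s)) \<subseteq> rgd_U_plus W S G U) \<and>
     carrier G = rgd_H W S G U <#>\<^bsub>G\<^esub> generate G (\<Union>\<alpha>\<in>roots W S. U \<alpha>)"

definition over_F2 ::
  "('a, 'b) monoid_scheme \<Rightarrow> 'a set \<Rightarrow> ('a set \<Rightarrow> 'g set) \<Rightarrow> bool" where
  "over_F2 W S U \<longleftrightarrow> (\<forall>\<alpha>\<in>roots W S. card (U \<alpha>) = 2)"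


section \<open>The positive building\<close>

definition rgd_B ::
  "('a, 'b) monoid_scheme \<Rightarrow> 'a set \<Rightarrow> ('g, 'h) monoid_scheme \<Rightarrow> ('a set \<Rightarrow> 'g set) \<Rightarrow> 'g set" where
  "rgd_B W S G U = rgd_H W S G U <#>\<^bsub>G\<^esub> rgd_U_plus W S G U"

definition rgd_N ::
  "('a, 'b) monoid_scheme \<Rightarrow> 'a set \<Rightarrow> ('g, 'h) monoid_scheme \<Rightarrow> ('a set \<Rightarrow> 'g set) \<Rightarrow> 'g set" where
  "rgd_N W S G U = generate G (rgd_H W S G U \<union>
     {m. \<exists>s\<in>S. \<exists>u\<in>U (simple_root W S s) - {\<one>\<^bsub>G\<^esub>}. is_m W S G U s u m})"

text \<open>\<open>f\<close> is the isomorphism from \<open>N/H\<close> onto \<open>W\<close> that sends \<open>m(u)H\<close> to \<open>s\<close>. As the cosets of the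
  \<open>m(u)\<close> generate \<open>N/H\<close>, there is at most one such \<open>f\<close> on the carrier of the quotient.\<close>

definition is_weyl_iso ::
  "('a, 'b) monoid_scheme \<Rightarrow> 'a set \<Rightarrow> ('g, 'h) monoid_scheme \<Rightarrow> ('a set \<Rightarrow> 'g set) \<Rightarrow>
     ('g set \<Rightarrow> 'a) \<Rightarrow> bool" where
  "is_weyl_iso W S G U f \<longleftrightarrow>
     f \<in> iso (G\<lparr>carrier := rgd_N W S G U\<rparr> Mod rgd_H W S G U) W \<and>
     (\<forall>s\<in>S. \<forall>u\<in>U (simple_root W S s) - {\<one>\<^bsub>G\<^esub>}. \<forall>m.
        is_m W S G U s u m \<longrightarrow> f (rgd_H W S G U #>\<^bsub>G\<^esub> m) = s)"

definition represents ::
  "('a, 'b) monoid_scheme \<Rightarrow> 'a set \<Rightarrow> ('g, 'h) monoid_scheme \<Rightarrow> ('a set \<Rightarrow> 'g set) \<Rightarrow>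
     'g \<Rightarrow> 'a \<Rightarrow> bool" where
  "represents W S G U n w \<longleftrightarrow>
     n \<in> rgd_N W S G U \<and> (\<exists>f. is_weyl_iso W S G U f \<and> f (rgd_H W S G U #>\<^bsub>G\<^esub> n) = w)"

definition chambers ::
  "('a, 'b) monoid_scheme \<Rightarrow> 'a set \<Rightarrow> ('g, 'h) monoid_scheme \<Rightarrow> ('a set \<Rightarrow> 'g set) \<Rightarrow> 'g set set" where
  "chambers W S G U = lcosets\<^bsub>G\<^esub> (rgd_B W S G U)"

text \<open>The graph of the Weyl distance: \<open>delta W S G U c d w\<close> stands for \<open>\<delta>(c, d) = w\<close>.\<close>

definition delta ::
  "('a, 'b) monoid_scheme \<Rightarrow> 'a set \<Rightarrow> ('g, 'h) monoid_scheme \<Rightarrow> ('a set \<Rightarrow> 'g set) \<Rightarrow>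
     'g set \<Rightarrow> 'g set \<Rightarrow> 'a \<Rightarrow> bool" where
  "delta W S G U c d w \<longleftrightarrow>
     (\<exists>g\<in>carrier G. \<exists>h\<in>carrier G. \<exists>n.
        c = g <#\<^bsub>G\<^esub> rgd_B W S G U \<and> d = h <#\<^bsub>G\<^esub> rgd_B W S G U \<and> represents W S G U n w \<and>
        inv\<^bsub>G\<^esub> g \<otimes>\<^bsub>G\<^esub> h \<in> (rgd_B W S G U #>\<^bsub>G\<^esub> n) <#>\<^bsub>G\<^esub> rgd_B W S G U)"

definition building_ball ::
  "('a, 'b) monoid_scheme \<Rightarrow> 'a set \<Rightarrow> ('g, 'h) monoid_scheme \<Rightarrow> ('a set \<Rightarrow> 'g set) \<Rightarrow>
     nat \<Rightarrow> 'g set set" where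
  "building_ball W S G U r =
     {c \<in> chambers W S G U.
        \<exists>w\<in>carrier W. delta W S G U (rgd_B W S G U) c w \<and> cox_length W S w \<le> r}"

definition FPRS ::
  "('a, 'b) monoid_scheme \<Rightarrow> 'a set \<Rightarrow> ('g, 'h) monoid_scheme \<Rightarrow> ('a set \<Rightarrow> 'g set) \<Rightarrow> bool" where
  "FPRS W S G U \<longleftrightarrow>
     (\<forall>\<alpha>. (\<forall>n::nat. \<alpha> n \<in> roots W S) \<and>
        filterlim (\<lambda>n. root_depth W S (\<alpha> n)) at_top sequentially \<longrightarrow>
        (\<forall>r. \<exists>n0. \<forall>n\<ge>n0. \<forall>u\<in>U (\<alpha> n). \<forall>c\<in>building_ball W S G U r. u <#\<^bsub>G\<^esub> c = c))"

end

theory Submission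
  imports Defs "HOL-Library.Sublist" "HOL-Library.Countable_Set"
begin

text \<open>
  In the Cayley tree of a universal Coxeter group a root is a half-tree, that is, an oriented edge,
  and a positive root corresponds to a nonempty reduced word \<open>p\<close>: the half-tree \<open>halfspace p\<close> of all
  elements whose reduced word does not begin with \<open>p\<close>. Two distinct roots are prenilpotent iff one
  contains the other, and the roots strictly between them are the edges on the path that joins the
  two edges. So commutator relations only have to be prescribed along paths of the tree.

  Fix a generator \<open>t\<close>. The system to be constructed has root groups \<open>{1, u\<^sub>\<alpha>}\<close> with the following
  relations for \<open>\<alpha> \<subset> \<beta>\<close>. If neither \<open>\<alpha>\<close> nor \<open>\<beta>\<close> is an edge of type \<open>t\<close>, and if the edge \<open>\<gamma>\<close> next to
  \<open>\<alpha>\<close> on the path towards \<open>\<beta>\<close> has type \<open>t\<close>, then \<open>[u\<^sub>\<alpha>, u\<^sub>\<beta>] = u\<^sub>\<gamma>\<close>; otherwise \<open>u\<^sub>\<alpha>\<close> and \<open>u\<^sub>\<beta>\<close> commute.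
  The rule is invariant under \<open>W\<close>, and along a path the edges of type \<open>t\<close> are central, so that the
  relations along a path define a group of nilpotency class at most two; this is why they are consistent.

  Property (FPRS) fails because \<open>\<gamma>\<close> does not depend on how far away \<open>\<beta>\<close> is. Take \<open>\<alpha>\<close> to be the first edge
  of the path \<open>a t a t a \<dots>\<close> that starts at \<open>1\<close>, and let \<open>\<beta>\<close> run through the other edges of type \<open>a\<close>.
  If the root groups of all distant \<open>\<beta>\<close> fixed a ball around the fundamental chamber, then so would
  the commutators \<open>[u\<^sub>\<alpha>, u\<^sub>\<beta>] = u\<^sub>\<gamma>\<close>, because \<open>u\<^sub>\<alpha>\<close> preserves the ball; but \<open>u\<^sub>\<gamma>\<close> moves a chamber at
  distance two (\<open>not_FPRS\<close>).

  It remains to realise the relations by a group whose root elements are nontrivial and satisfy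
  (RGD3). For every \<open>s\<close> let a symmetric group \<open>S\<^sub>3\<close>, generated by the involutions \<open>u\<^sub>s\<close> and
  \<open>m\<^sub>s\<close>, act on galleries \<open>(s\<^sub>1, x\<^sub>1) \<dots> (s\<^sub>k, x\<^sub>k)\<close> with \<open>s\<^sub>i \<noteq> s\<^sub>i\<^sub>+\<^sub>1\<close> and bits \<open>x\<^sub>i\<close>. These are the chambers
  of the future building, each panel having three chambers. The root elements are the conjugates of
  the \<open>u\<^sub>s\<close> under the group generated by the \<open>m\<^sub>s\<close>. The action of the positive root elements is
  defined by recursion on the gallery, reading off from the relations what \<open>u\<^sub>p\<close> does to the tail of
  a gallery, and the relations follow by induction on its length (\<open>relations_at\<close>). All positive root
  elements fix the empty gallery, while \<open>m\<^sub>s u\<^sub>s m\<^sub>s\<close> moves it, which gives (RGD3). The empty gallery is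
  the only gallery fixed by all \<open>u\<^sub>s\<close>, so it is fixed by \<open>H\<close> as well and hence by \<open>B\<^sub>+ = H U\<^sub>+\<close>.
\<close>


section \<open>Reduced words\<close>

text \<open>Left multiplication by a generator, in terms of reduced words.\<close>

definition cancel :: "'a \<Rightarrow> 'a list \<Rightarrow> 'a list" where
  "cancel s w = (case w of [] \<Rightarrow> [s] | a # v \<Rightarrow> if a = s then v else s # w)"

definition reduce :: "'a list \<Rightarrow> 'a list" where
  "reduce ws = foldr cancel ws []"

lemma cancel_simps [simp]:
  "cancel s [] = [s]"
  "cancel s (a # v) = (if a = s then v else s # a # v)"
  by (simp_all add: cancel_def)

lemma reduce_simps [simp]:
  "reduce [] = []"
  "reduce (s # ws) = cancel s (reduce ws)"
  by (simp_all add: reduce_def)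

lemma distinct_adj_cancel: "distinct_adj w \<Longrightarrow> distinct_adj (cancel s w)"
  by (cases w) (auto simp: distinct_adj_Cons)

lemma cancel_cancel: "distinct_adj w \<Longrightarrow> cancel s (cancel s w) = w"
  by (cases w; cases "tl w") (auto simp: distinct_adj_Cons)

lemma distinct_adj_reduce: "distinct_adj (reduce ws)"
  by (induction ws) (auto intro: distinct_adj_cancel)

lemma reduce_reduced: "distinct_adj ws \<Longrightarrow> reduce ws = ws"
proof (induction ws)
  case (Cons s ws)
  then show ?case by (cases ws) auto
qed simp

lemma set_cancel: "set (cancel s w) \<subseteq> insert s (set w)"
  by (cases w) auto

lemma reduce_in_lists: "ws \<in> lists S \<Longrightarrow> reduce ws \<in> lists S"
proof (induction ws)
  case (Cons s ws)
  then show ?case using set_cancel[of s "reduce ws"] by (auto simp: in_lists_conv_set)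
qed simp

lemma length_reduce: "length (reduce ws) \<le> length ws"
proof (induction ws)
  case (Cons s ws)
  then show ?case by (cases "reduce ws") auto
qed simp

lemma reduce_delete_pair: "reduce (xs @ s # s # ys) = reduce (xs @ ys)"
  by (induction xs) (simp_all add: cancel_cancel distinct_adj_reduce)

lemma word_val_simps [simp]:
  "word_val W [] = \<one>\<^bsub>W\<^esub>"
  "word_val W (s # ws) = s \<otimes>\<^bsub>W\<^esub> word_val W ws"
  by (simp_all add: word_val_def)


section \<open>Normal forms in a universal Coxeter group\<close>

locale universal_coxeter =
  fixes W :: "('a, 'b) monoid_scheme" and S :: "'a set"
  assumes universal: "universal_coxeter_system W S"
begin

sublocale W: group W
  using universal by (simp add: universal_coxeter_system_def coxeter_system_def)

lemma S_carrier: "s \<in> S \<Longrightarrow> s \<in> carrier W"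
  using universal by (auto simp: universal_coxeter_system_def coxeter_system_def)

lemma S_involution: "s \<in> S \<Longrightarrow> s \<otimes>\<^bsub>W\<^esub> s = \<one>\<^bsub>W\<^esub>"
proof -
  assume s: "s \<in> S"
  then have "W.ord s = 2"
    using universal by (auto simp: universal_coxeter_system_def coxeter_system_def)
  then show ?thesis
    using W.pow_ord_eq_1[OF S_carrier[OF s]] S_carrier[OF s] by (simp add: numeral_2_eq_2)
qed

lemma S_inv: "s \<in> S \<Longrightarrow> inv\<^bsub>W\<^esub> s = s"
  using S_involution S_carrier W.inv_equality by blast

lemma S_cancel: "s \<in> S \<Longrightarrow> w \<in> carrier W \<Longrightarrow> s \<otimes>\<^bsub>W\<^esub> (s \<otimes>\<^bsub>W\<^esub> w) = w"
  by (metis S_involution S_carrier W.m_assoc W.l_one)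

lemma word_val_closed [simp]: "ws \<in> lists S \<Longrightarrow> word_val W ws \<in> carrier W"
  by (induction ws) (auto simp: S_carrier)

lemma word_val_append:
  "us \<in> lists S \<Longrightarrow> vs \<in> lists S \<Longrightarrow> word_val W (us @ vs) = word_val W us \<otimes>\<^bsub>W\<^esub> word_val W vs"
  by (induction us) (auto simp: S_carrier W.m_assoc)

lemma word_val_cancel:
  "s \<in> S \<Longrightarrow> w \<in> lists S \<Longrightarrow> word_val W (cancel s w) = s \<otimes>\<^bsub>W\<^esub> word_val W w"
  by (cases w) (auto simp: S_cancel)

lemma word_val_reduce: "ws \<in> lists S \<Longrightarrow> word_val W (reduce ws) = word_val W ws"
  by (induction ws) (auto simp: word_val_cancel reduce_in_lists)

lemma word_val_rev: "ws \<in> lists S \<Longrightarrow> word_val W (rev ws) = inv\<^bsub>W\<^esub> (word_val W ws)"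
proof (induction ws)
  case (Cons s ws)
  then have "rev ws \<in> lists S" by (simp add: in_lists_conv_set)
  then have "word_val W (rev ws @ [s]) = word_val W (rev ws) \<otimes>\<^bsub>W\<^esub> s"
    using Cons.prems by (simp add: word_val_append S_carrier)
  then show ?case
    using Cons by (simp add: W.inv_mult_group S_inv S_carrier)
qed simp

text \<open>Since \<open>st\<close> has infinite order for \<open>s \<noteq> t\<close>, only the relators \<open>ss\<close> can be deleted, and
  \<open>reduce\<close> does not notice that. So \<open>reduce\<close> solves the word problem.\<close>

lemma coxeter_step_reduce:
  assumes "coxeter_step W S us vs"
  shows "reduce us = reduce vs"
proof -
  from assms obtain xs ys s t where *: "s \<in> S" "t \<in> S"
    "us = xs @ concat (replicate (W.ord (s \<otimes>\<^bsub>W\<^esub> t)) [s, t]) @ ys" "vs = xs @ ys"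
    unfolding coxeter_step_def by blast
  show ?thesis
  proof (cases "s = t")
    case True
    then have "W.ord (s \<otimes>\<^bsub>W\<^esub> t) = 1"
      using * by (simp add: S_involution)
    then show ?thesis using * True by (simp add: reduce_delete_pair)
  next
    case False
    then have "W.ord (s \<otimes>\<^bsub>W\<^esub> t) = 0"
      using * universal by (simp add: universal_coxeter_system_def)
    then show ?thesis using * by simp
  qed
qed

lemma word_val_eq_reduce:
  assumes "us \<in> lists S" "vs \<in> lists S"
  shows "word_val W us = word_val W vs \<longleftrightarrow> reduce us = reduce vs"
proof
  assume "word_val W us = word_val W vs"
  then have "equivclp (coxeter_step W S) us vs"
    using universal assms by (simp add: universal_coxeter_system_def coxeter_system_def)
  then show "reduce us = reduce vs"
    by (induction rule: equivclp_induct) (auto simp: coxeter_step_reduce)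
next
  assume "reduce us = reduce vs"
  then show "word_val W us = word_val W vs"
    using word_val_reduce assms by metis
qed

lemma carrier_word_val: "w \<in> carrier W \<Longrightarrow> \<exists>ws\<in>lists S. word_val W ws = w"
proof -
  assume "w \<in> carrier W"
  then have "w \<in> generate W S"
    using universal by (simp add: universal_coxeter_system_def coxeter_system_def)
  then show ?thesis
  proof (induction rule: generate.induct)
    case one
    show ?case by (rule bexI[of _ "[]"]) auto
  next
    case (incl h)
    then show ?case by (intro bexI[of _ "[h]"]) (auto simp: S_carrier)
  next
    case (inv h)
    then show ?case by (intro bexI[of _ "[h]"]) (auto simp: S_carrier S_inv)
  next
    case (eng h1 h2)
    then show ?case by (metis append_in_lists_conv word_val_append)
  qed
qed

definition nf :: "'a \<Rightarrow> 'a list" where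
  "nf w = reduce (SOME ws. ws \<in> lists S \<and> word_val W ws = w)"

lemma nf_word_val: "ws \<in> lists S \<Longrightarrow> nf (word_val W ws) = reduce ws"
proof -
  assume ws: "ws \<in> lists S"
  define us where "us = (SOME us. us \<in> lists S \<and> word_val W us = word_val W ws)"
  have "us \<in> lists S \<and> word_val W us = word_val W ws"
    unfolding us_def by (rule someI[of _ ws]) (simp add: ws)
  then show ?thesis
    using word_val_eq_reduce ws unfolding nf_def us_def[symmetric] by blast
qed

lemma nf_props:
  assumes "w \<in> carrier W"
  shows nf_in_lists: "nf w \<in> lists S" and word_val_nf: "word_val W (nf w) = w"
    and distinct_adj_nf: "distinct_adj (nf w)"
proof -
  obtain ws where "ws \<in> lists S" "word_val W ws = w"
    using carrier_word_val assms by blast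
  then show "nf w \<in> lists S" "word_val W (nf w) = w" "distinct_adj (nf w)"
    using nf_word_val reduce_in_lists word_val_reduce distinct_adj_reduce by metis+
qed

lemma nf_one [simp]: "nf \<one>\<^bsub>W\<^esub> = []"
  using nf_word_val[of "[]"] by simp

lemma nf_mult: "s \<in> S \<Longrightarrow> w \<in> carrier W \<Longrightarrow> nf (s \<otimes>\<^bsub>W\<^esub> w) = cancel s (nf w)"
  using nf_word_val[of "s # nf w"] nf_in_lists[of w] word_val_nf[of w] distinct_adj_nf[of w]
  by (simp add: reduce_reduced)

lemma nf_reduced: "ws \<in> lists S \<Longrightarrow> distinct_adj ws \<Longrightarrow> nf (word_val W ws) = ws"
  by (simp add: nf_word_val reduce_reduced)

lemma nf_inv: "w \<in> carrier W \<Longrightarrow> nf (inv\<^bsub>W\<^esub> w) = rev (nf w)"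
  using word_val_rev[of "nf w"] nf_reduced[of "rev (nf w)"] nf_in_lists[of w]
  by (simp add: word_val_nf distinct_adj_nf in_lists_conv_set)

lemma cox_length_nf:
  assumes "w \<in> carrier W"
  shows "cox_length W S w = length (nf w)"
  unfolding cox_length_def
proof (rule Least_equality)
  show "\<exists>ws\<in>lists S. length ws = length (nf w) \<and> word_val W ws = w"
    using nf_in_lists word_val_nf assms by blast
next
  fix n assume "\<exists>ws\<in>lists S. length ws = n \<and> word_val W ws = w"
  then show "length (nf w) \<le> n"
    using nf_word_val length_reduce by metis
qed


section \<open>Roots as half-trees\<close>

definition halfspace :: "'a list \<Rightarrow> 'a set" where
  "halfspace p = {w \<in> carrier W. \<not> prefix p (nf w)}"

lemma halfspace_carrier: "halfspace p \<subseteq> carrier W"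
  by (auto simp: halfspace_def)

lemma simple_root_halfspace: "s \<in> S \<Longrightarrow> simple_root W S s = halfspace [s]"
proof -
  assume s: "s \<in> S"
  have "cox_length W S (s \<otimes>\<^bsub>W\<^esub> w) > cox_length W S w \<longleftrightarrow> \<not> prefix [s] (nf w)"
    if "w \<in> carrier W" for w
    using that s by (cases "nf w") (auto simp: cox_length_nf nf_mult S_carrier)
  then show ?thesis by (auto simp: simple_root_def halfspace_def)
qed

lemma mem_l_coset_iff:
  assumes "v \<in> carrier W" "A \<subseteq> carrier W" "w \<in> carrier W"
  shows "w \<in> v <#\<^bsub>W\<^esub> A \<longleftrightarrow> inv\<^bsub>W\<^esub> v \<otimes>\<^bsub>W\<^esub> w \<in> A"
proof
  assume "w \<in> v <#\<^bsub>W\<^esub> A"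
  then obtain a where "a \<in> A" "w = v \<otimes>\<^bsub>W\<^esub> a" by (auto simp: l_coset_def)
  then show "inv\<^bsub>W\<^esub> v \<otimes>\<^bsub>W\<^esub> w \<in> A"
    using assms by (metis W.inv_solve_left' subsetD)
next
  assume "inv\<^bsub>W\<^esub> v \<otimes>\<^bsub>W\<^esub> w \<in> A"
  moreover have "w = v \<otimes>\<^bsub>W\<^esub> (inv\<^bsub>W\<^esub> v \<otimes>\<^bsub>W\<^esub> w)"
    using assms by (simp add: W.m_assoc[symmetric])
  ultimately show "w \<in> v <#\<^bsub>W\<^esub> A" by (auto simp: l_coset_def)
qed

text \<open>For \<open>p\<close> that does not begin with \<open>s\<close>, an element \<open>w\<close> begins with \<open>s p\<close> iff \<open>s w\<close> begins with \<open>p\<close>.\<close>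

lemma halfspace_Cons:
  assumes "s \<in> S" "p \<noteq> []" "hd p \<noteq> s"
  shows "s <#\<^bsub>W\<^esub> halfspace p = halfspace (s # p)"
proof -
  have *: "prefix p (cancel s v) \<longleftrightarrow> prefix (s # p) v" if "distinct_adj v" for v
    using that assms by (cases v; cases p; cases "tl v") (auto simp: distinct_adj_Cons)
  have "w \<in> s <#\<^bsub>W\<^esub> halfspace p \<longleftrightarrow> w \<in> halfspace (s # p)" if w: "w \<in> carrier W" for w
  proof -
    have "w \<in> s <#\<^bsub>W\<^esub> halfspace p \<longleftrightarrow> s \<otimes>\<^bsub>W\<^esub> w \<in> halfspace p"
      using assms w by (simp add: mem_l_coset_iff S_carrier halfspace_carrier S_inv)
    also have "\<dots> \<longleftrightarrow> \<not> prefix p (cancel s (nf w))"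
      using assms w by (simp add: halfspace_def nf_mult S_carrier)
    also have "\<dots> \<longleftrightarrow> w \<in> halfspace (s # p)"
      using w by (simp add: * distinct_adj_nf halfspace_def)
    finally show ?thesis .
  qed
  moreover have "s <#\<^bsub>W\<^esub> halfspace p \<subseteq> carrier W"
    using assms by (simp add: W.l_coset_subset_G halfspace_carrier S_carrier)
  ultimately show ?thesis using halfspace_carrier by blast
qed

lemma halfspace_eq_l_coset:
  assumes "us \<in> lists S" "s \<in> S" "distinct_adj (us @ [s])"
  shows "word_val W us <#\<^bsub>W\<^esub> simple_root W S s = halfspace (us @ [s])"
  using assms
proof (induction us)
  case Nil
  then show ?case
    by (simp add: simple_root_halfspace halfspace_carrier W.lcos_mult_one)
next
  case (Cons a us)
  then have *: "hd (us @ [s]) \<noteq> a" "distinct_adj (us @ [s])"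
    by (auto simp: distinct_adj_Cons)
  have "word_val W (a # us) <#\<^bsub>W\<^esub> simple_root W S s
      = a <#\<^bsub>W\<^esub> (word_val W us <#\<^bsub>W\<^esub> simple_root W S s)"
    using Cons by (simp add: W.lcos_m_assoc S_carrier simple_root_halfspace halfspace_carrier)
  also have "\<dots> = halfspace (a # us @ [s])"
    using Cons * by (simp add: halfspace_Cons)
  finally show ?case by simp
qed

lemma simple_root_carrier: "simple_root W S s \<subseteq> carrier W"
  by (auto simp: simple_root_def)

lemma one_mem_root_iff:
  assumes "v \<in> carrier W" "s \<in> S"
  shows "\<one>\<^bsub>W\<^esub> \<in> v <#\<^bsub>W\<^esub> simple_root W S s \<longleftrightarrow> distinct_adj (nf v @ [s])"
proof -
  have "\<one>\<^bsub>W\<^esub> \<in> v <#\<^bsub>W\<^esub> simple_root W S s \<longleftrightarrow> \<not> prefix [s] (rev (nf v))"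
    using assms by (simp add: mem_l_coset_iff simple_root_halfspace halfspace_carrier)
      (simp add: halfspace_def nf_inv)
  also have "\<dots> \<longleftrightarrow> distinct_adj (nf v @ [s])"
    using distinct_adj_nf[OF assms(1)]
    by (cases "nf v" rule: rev_cases) (auto simp: distinct_adj_append_iff)
  finally show ?thesis .
qed

lemma positive_root_halfspace:
  assumes "v \<in> carrier W" "s \<in> S" "\<one>\<^bsub>W\<^esub> \<in> v <#\<^bsub>W\<^esub> simple_root W S s"
  shows "v <#\<^bsub>W\<^esub> simple_root W S s = halfspace (nf v @ [s])" "distinct_adj (nf v @ [s])"
  using assms one_mem_root_iff[OF assms(1,2)] halfspace_eq_l_coset[of "nf v" s]
  by (simp_all add: nf_in_lists word_val_nf)

text \<open>The element \<open>q\<close> itself witnesses a failing inclusion.\<close>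

lemma halfspace_subset_iff:
  assumes "p \<in> lists S" "distinct_adj p" "q \<in> lists S" "distinct_adj q"
  shows "halfspace p \<subseteq> halfspace q \<longleftrightarrow> prefix p q"
proof
  assume "halfspace p \<subseteq> halfspace q"
  moreover have "word_val W q \<notin> halfspace q" "word_val W q \<in> carrier W"
    using assms by (simp_all add: halfspace_def nf_reduced)
  ultimately have "word_val W q \<notin> halfspace p" by blast
  then show "prefix p q" using assms by (simp add: halfspace_def nf_reduced)
next
  assume "prefix p q"
  then show "halfspace p \<subseteq> halfspace q"
    by (auto simp: halfspace_def dest: prefix_order.trans)
qed

lemma l_coset_inj:
  assumes "x \<in> carrier W" "A \<subseteq> carrier W" "B \<subseteq> carrier W"
  shows "x <#\<^bsub>W\<^esub> A \<subseteq> x <#\<^bsub>W\<^esub> B \<longleftrightarrow> A \<subseteq> B"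
proof
  assume *: "x <#\<^bsub>W\<^esub> A \<subseteq> x <#\<^bsub>W\<^esub> B"
  show "A \<subseteq> B"
  proof
    fix a assume a: "a \<in> A"
    then have "x \<otimes>\<^bsub>W\<^esub> a \<in> x <#\<^bsub>W\<^esub> B" using * by (auto simp: l_coset_def)
    then obtain b where "b \<in> B" "x \<otimes>\<^bsub>W\<^esub> a = x \<otimes>\<^bsub>W\<^esub> b" by (auto simp: l_coset_def)
    then show "a \<in> B" using a assms by (metis W.l_cancel subsetD)
  qed
qed (auto simp: l_coset_def)

lemma l_coset_assoc:
  "x \<in> carrier W \<Longrightarrow> v \<in> carrier W \<Longrightarrow>
    x <#\<^bsub>W\<^esub> (v <#\<^bsub>W\<^esub> simple_root W S s) = (x \<otimes>\<^bsub>W\<^esub> v) <#\<^bsub>W\<^esub> simple_root W S s"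
  by (simp add: W.lcos_m_assoc simple_root_carrier)

lemma root_carrier: "\<alpha> \<in> roots W S \<Longrightarrow> \<alpha> \<subseteq> carrier W"
  unfolding roots_def using W.l_coset_subset_G[OF simple_root_carrier] by blast

lemma root_translate: "x \<in> carrier W \<Longrightarrow> \<alpha> \<in> roots W S \<Longrightarrow> x <#\<^bsub>W\<^esub> \<alpha> \<in> roots W S"
  unfolding roots_def using l_coset_assoc W.m_closed by blast

lemma simple_root_root: "s \<in> S \<Longrightarrow> simple_root W S s \<in> roots W S"
  unfolding roots_def using W.lcos_mult_one[OF simple_root_carrier] W.one_closed by blast

lemma root_nonempty: "\<alpha> \<in> roots W S \<Longrightarrow> \<alpha> \<noteq> {}"
  by (auto simp: roots_def l_coset_def simple_root_halfspace)
   (auto simp: halfspace_def intro!: exI[of _ "\<one>\<^bsub>W\<^esub>"])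

text \<open>\<open>W\<close> acts freely on the oriented edges of its Cayley tree, so a root element may be defined from \<open>v\<close>
  and \<open>s\<close> instead of the root \<open>v\<alpha>\<^sub>s\<close>. For the proof, the root is translated to one that contains \<open>1\<close>, which determines
  the reduced word of its edge.\<close>

lemma root_unique:
  assumes v: "v \<in> carrier W" "s \<in> S" and v': "v' \<in> carrier W" "s' \<in> S"
    and eq: "v <#\<^bsub>W\<^esub> simple_root W S s = v' <#\<^bsub>W\<^esub> simple_root W S s'"
  shows "v = v' \<and> s = s'"
proof -
  define A where "A = v <#\<^bsub>W\<^esub> simple_root W S s"
  have r: "A \<in> roots W S" using v by (auto simp: A_def roots_def)
  then obtain x where x: "x \<in> A" "x \<in> carrier W"
    using root_nonempty root_carrier by blast
  define y where "y = inv\<^bsub>W\<^esub> x"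
  have y: "y \<in> carrier W" "\<one>\<^bsub>W\<^esub> \<in> y <#\<^bsub>W\<^esub> A"
    using x root_carrier[OF r] by (simp_all add: y_def mem_l_coset_iff)
  have A: "y <#\<^bsub>W\<^esub> A = (y \<otimes>\<^bsub>W\<^esub> v) <#\<^bsub>W\<^esub> simple_root W S s"
    unfolding A_def by (rule l_coset_assoc[OF y(1) v(1)])
  have A': "y <#\<^bsub>W\<^esub> A = (y \<otimes>\<^bsub>W\<^esub> v') <#\<^bsub>W\<^esub> simple_root W S s'"
    unfolding A_def eq by (rule l_coset_assoc[OF y(1) v'(1)])
  define p where "p = nf (y \<otimes>\<^bsub>W\<^esub> v) @ [s]"
  define p' where "p' = nf (y \<otimes>\<^bsub>W\<^esub> v') @ [s']"
  have p: "y <#\<^bsub>W\<^esub> A = halfspace p" "distinct_adj p" "p \<in> lists S"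
    using positive_root_halfspace[of "y \<otimes>\<^bsub>W\<^esub> v" s] y v nf_in_lists[of "y \<otimes>\<^bsub>W\<^esub> v"]
    unfolding A p_def by simp_all
  have p': "y <#\<^bsub>W\<^esub> A = halfspace p'" "distinct_adj p'" "p' \<in> lists S"
    using positive_root_halfspace[of "y \<otimes>\<^bsub>W\<^esub> v'" s'] y v' nf_in_lists[of "y \<otimes>\<^bsub>W\<^esub> v'"]
    unfolding A' p'_def by simp_all
  have "p = p'"
    using halfspace_subset_iff[of p p'] halfspace_subset_iff[of p' p] p p' prefix_order.antisym
    by (metis order_refl)
  then have "nf (y \<otimes>\<^bsub>W\<^esub> v) = nf (y \<otimes>\<^bsub>W\<^esub> v')" "s = s'"
    by (simp_all add: p_def p'_def)
  then have "y \<otimes>\<^bsub>W\<^esub> v = y \<otimes>\<^bsub>W\<^esub> v'"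
    using word_val_nf y(1) v(1) v'(1) by (metis W.m_closed)
  then show ?thesis
    using y(1) v(1) v'(1) \<open>s = s'\<close> by simp
qed

lemma l_coset_inverse_cancel:
  assumes "x \<in> carrier W" "A \<subseteq> carrier W"
  shows "x <#\<^bsub>W\<^esub> (inv\<^bsub>W\<^esub> x <#\<^bsub>W\<^esub> A) = A"
  using assms by (simp add: W.lcos_m_assoc W.lcos_mult_one)

lemma opp_simple_root:
  assumes "s \<in> S"
  shows "opp W (simple_root W S s) = s <#\<^bsub>W\<^esub> simple_root W S s"
proof -
  have *: "prefix [s] v \<longleftrightarrow> \<not> prefix [s] (cancel s v)" if "distinct_adj v" for v
    using that by (cases v; cases "tl v") (auto simp: distinct_adj_Cons)
  have "w \<in> opp W (simple_root W S s) \<longleftrightarrow> w \<in> s <#\<^bsub>W\<^esub> simple_root W S s"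
    if w: "w \<in> carrier W" for w
  proof -
    have "w \<in> s <#\<^bsub>W\<^esub> simple_root W S s \<longleftrightarrow> s \<otimes>\<^bsub>W\<^esub> w \<in> simple_root W S s"
      using assms w by (simp add: mem_l_coset_iff S_carrier simple_root_carrier S_inv)
    also have "\<dots> \<longleftrightarrow> \<not> prefix [s] (cancel s (nf w))"
      using assms w by (simp add: simple_root_halfspace halfspace_def nf_mult S_carrier)
    also have "\<dots> \<longleftrightarrow> w \<in> opp W (simple_root W S s)"
      using *[OF distinct_adj_nf[OF w]] w assms
      by (simp add: simple_root_halfspace opp_def) (simp add: halfspace_def)
    finally show ?thesis by simp
  qed
  moreover have "s <#\<^bsub>W\<^esub> simple_root W S s \<subseteq> carrier W"
    using assms by (simp add: W.l_coset_subset_G simple_root_carrier S_carrier)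
  moreover have "opp W (simple_root W S s) \<subseteq> carrier W" by (auto simp: opp_def)
  ultimately show ?thesis by blast
qed

end


section \<open>Root elements in a group that acts with a base point\<close>

context group
begin

lemma involution_inv:
  "x \<in> carrier G \<Longrightarrow> x \<otimes> x = \<one> \<Longrightarrow> inv x = x"
  using inv_equality by blast

lemma conj_mult:
  assumes "g \<in> carrier G" "x \<in> carrier G" "y \<in> carrier G"
  shows "(g \<otimes> x \<otimes> inv g) \<otimes> (g \<otimes> y \<otimes> inv g) = g \<otimes> (x \<otimes> y) \<otimes> inv g"
proof -
  have "inv g \<otimes> (g \<otimes> z) = z" if "z \<in> carrier G" for z
    using assms that by (simp add: m_assoc[symmetric])
  then show ?thesis using assms by (simp add: m_assoc)
qed

lemma conj_conj:
  assumes "g \<in> carrier G" "h \<in> carrier G" "x \<in> carrier G"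
  shows "g \<otimes> (h \<otimes> x \<otimes> inv h) \<otimes> inv g = (g \<otimes> h) \<otimes> x \<otimes> inv (g \<otimes> h)"
  using assms by (simp add: m_assoc inv_mult_group)

lemma conj_one_iff:
  assumes "g \<in> carrier G" "x \<in> carrier G"
  shows "g \<otimes> x \<otimes> inv g = \<one> \<longleftrightarrow> x = \<one>"
  using assms inv_solve_right[of "\<one>" "g \<otimes> x" g] r_cancel_one[of g x] by auto

end

text \<open>The root elements will be the conjugates of the \<open>u s\<close> under the image of \<open>m\<close>, which makes their family
  invariant under \<open>W\<close> by construction; the braid relation gives (RGD2). The last two assumptions single out
  \<open>x0\<close> as the fundamental chamber: in its orbit it is the only point fixed by all \<open>u s\<close>, and the root
  elements of the negative simple roots move it.\<close>

locale rgd_action = universal_coxeter W S + G: group G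
  for W :: "('a, 'b) monoid_scheme" and S and G :: "('g, 'h) monoid_scheme" +
  fixes m :: "'a \<Rightarrow> 'g" and u :: "'a \<Rightarrow> 'g" and act :: "'g \<Rightarrow> 'x \<Rightarrow> 'x" and x0 :: 'x
  assumes m_hom: "m \<in> hom W G"
    and u_closed: "s \<in> S \<Longrightarrow> u s \<in> carrier G"
    and u_involution: "s \<in> S \<Longrightarrow> u s \<otimes>\<^bsub>G\<^esub> u s = \<one>\<^bsub>G\<^esub>"
    and braid: "s \<in> S \<Longrightarrow> u s \<otimes>\<^bsub>G\<^esub> m s \<otimes>\<^bsub>G\<^esub> u s = m s \<otimes>\<^bsub>G\<^esub> u s \<otimes>\<^bsub>G\<^esub> m s"
    and generated: "carrier G = generate G (u ` S \<union> m ` S)"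
    and act_one: "act \<one>\<^bsub>G\<^esub> x = x"
    and act_mult: "g \<in> carrier G \<Longrightarrow> h \<in> carrier G \<Longrightarrow> act (g \<otimes>\<^bsub>G\<^esub> h) x = act g (act h x)"
    and fixed_point_unique: "g \<in> carrier G \<Longrightarrow> (\<And>s. s \<in> S \<Longrightarrow> act (u s) (act g x0) = act g x0)
          \<Longrightarrow> act g x0 = x0"
    and moved: "s \<in> S \<Longrightarrow> act (m s \<otimes>\<^bsub>G\<^esub> u s \<otimes>\<^bsub>G\<^esub> m s) x0 \<noteq> x0"
begin

definition conj_u :: "'a \<Rightarrow> 'a \<Rightarrow> 'g" where
  "conj_u v s = m v \<otimes>\<^bsub>G\<^esub> u s \<otimes>\<^bsub>G\<^esub> inv\<^bsub>G\<^esub> (m v)"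

text \<open>The root element of the positive root \<open>halfspace p\<close>; see \<open>root_u_halfspace\<close>.\<close>

definition word_u :: "'a list \<Rightarrow> 'g" where
  "word_u p = conj_u (word_val W (butlast p)) (last p)"

definition root_u :: "'a set \<Rightarrow> 'g" where
  "root_u \<alpha> = (THE g. \<exists>v\<in>carrier W. \<exists>s\<in>S. \<alpha> = v <#\<^bsub>W\<^esub> simple_root W S s \<and> g = conj_u v s)"

definition U :: "'a set \<Rightarrow> 'g set" where
  "U \<alpha> = {\<one>\<^bsub>G\<^esub>, root_u \<alpha>}"

lemma m_closed [simp]: "w \<in> carrier W \<Longrightarrow> m w \<in> carrier G"
  using m_hom by (auto simp: hom_def)

lemma m_mult: "v \<in> carrier W \<Longrightarrow> w \<in> carrier W \<Longrightarrow> m (v \<otimes>\<^bsub>W\<^esub> w) = m v \<otimes>\<^bsub>G\<^esub> m w"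
  using m_hom by (auto simp: hom_def)

lemma m_one: "m \<one>\<^bsub>W\<^esub> = \<one>\<^bsub>G\<^esub>"
  using hom_one[OF m_hom W.is_group G.is_group] .

lemma m_S_square: "s \<in> S \<Longrightarrow> m s \<otimes>\<^bsub>G\<^esub> m s = \<one>\<^bsub>G\<^esub>"
  using m_mult[of s s] by (simp add: S_carrier S_involution m_one)

lemma m_S_inv: "s \<in> S \<Longrightarrow> inv\<^bsub>G\<^esub> (m s) = m s"
  by (simp add: G.involution_inv S_carrier m_S_square)

lemma conj_u_closed [simp]: "v \<in> carrier W \<Longrightarrow> s \<in> S \<Longrightarrow> conj_u v s \<in> carrier G"
  by (simp add: conj_u_def u_closed)

lemma conj_u_square: "v \<in> carrier W \<Longrightarrow> s \<in> S \<Longrightarrow> conj_u v s \<otimes>\<^bsub>G\<^esub> conj_u v s = \<one>\<^bsub>G\<^esub>"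
  by (simp add: conj_u_def G.conj_mult u_closed u_involution)

lemma u_nontrivial: "s \<in> S \<Longrightarrow> u s \<noteq> \<one>\<^bsub>G\<^esub>"
  using moved[of s] by (auto simp: S_carrier m_S_square act_one)

lemma root_u_l_coset:
  assumes "v \<in> carrier W" "s \<in> S"
  shows "root_u (v <#\<^bsub>W\<^esub> simple_root W S s) = conj_u v s"
  unfolding root_u_def
proof (rule the_equality)
  show "\<exists>va\<in>carrier W. \<exists>sa\<in>S. v <#\<^bsub>W\<^esub> simple_root W S s = va <#\<^bsub>W\<^esub> simple_root W S sa \<and> conj_u v s = conj_u va sa"
    using assms by blast
next
  fix g
  assume "\<exists>va\<in>carrier W. \<exists>sa\<in>S. v <#\<^bsub>W\<^esub> simple_root W S s = va <#\<^bsub>W\<^esub> simple_root W S sa \<and> g = conj_u va sa"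
  then show "g = conj_u v s" using root_unique[OF assms] by blast
qed

lemma root_cases:
  assumes "\<alpha> \<in> roots W S"
  obtains v s where "v \<in> carrier W" "s \<in> S" "\<alpha> = v <#\<^bsub>W\<^esub> simple_root W S s" "root_u \<alpha> = conj_u v s"
  using assms root_u_l_coset unfolding roots_def by blast

lemma root_u_closed [simp]: "\<alpha> \<in> roots W S \<Longrightarrow> root_u \<alpha> \<in> carrier G"
  by (elim root_cases) simp

lemma root_u_square: "\<alpha> \<in> roots W S \<Longrightarrow> root_u \<alpha> \<otimes>\<^bsub>G\<^esub> root_u \<alpha> = \<one>\<^bsub>G\<^esub>"
  by (elim root_cases) (simp add: conj_u_square)

lemma root_u_inv: "\<alpha> \<in> roots W S \<Longrightarrow> inv\<^bsub>G\<^esub> (root_u \<alpha>) = root_u \<alpha>"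
  by (simp add: G.involution_inv root_u_square)

lemma root_u_nontrivial: "\<alpha> \<in> roots W S \<Longrightarrow> root_u \<alpha> \<noteq> \<one>\<^bsub>G\<^esub>"
  by (elim root_cases) (simp add: conj_u_def G.conj_one_iff u_closed u_nontrivial)

lemma root_u_translate:
  assumes "x \<in> carrier W" "\<alpha> \<in> roots W S"
  shows "m x \<otimes>\<^bsub>G\<^esub> root_u \<alpha> \<otimes>\<^bsub>G\<^esub> inv\<^bsub>G\<^esub> (m x) = root_u (x <#\<^bsub>W\<^esub> \<alpha>)"
proof -
  obtain v s where v: "v \<in> carrier W" "s \<in> S" "\<alpha> = v <#\<^bsub>W\<^esub> simple_root W S s" "root_u \<alpha> = conj_u v s"
    using root_cases assms by blast
  have "x <#\<^bsub>W\<^esub> \<alpha> = (x \<otimes>\<^bsub>W\<^esub> v) <#\<^bsub>W\<^esub> simple_root W S s"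
    unfolding v(3) using l_coset_assoc[OF assms(1) v(1)] .
  then have "root_u (x <#\<^bsub>W\<^esub> \<alpha>) = conj_u (x \<otimes>\<^bsub>W\<^esub> v) s"
    using root_u_l_coset[of "x \<otimes>\<^bsub>W\<^esub> v" s] assms v by simp
  then show ?thesis
    using assms v(1,2,4) by (simp add: conj_u_def G.conj_conj u_closed m_mult)
qed

lemma root_u_simple: "s \<in> S \<Longrightarrow> root_u (simple_root W S s) = u s"
  using root_u_l_coset[of "\<one>\<^bsub>W\<^esub>" s]
  by (simp add: W.lcos_mult_one simple_root_carrier conj_u_def m_one u_closed)

lemma root_u_opp_simple: "s \<in> S \<Longrightarrow> root_u (opp W (simple_root W S s)) = m s \<otimes>\<^bsub>G\<^esub> u s \<otimes>\<^bsub>G\<^esub> m s"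
  by (simp add: opp_simple_root root_u_l_coset S_carrier conj_u_def m_S_inv)

lemma opp_simple_root_root: "s \<in> S \<Longrightarrow> opp W (simple_root W S s) \<in> roots W S"
  by (simp add: opp_simple_root root_translate S_carrier simple_root_root)

lemma halfspace_decomp:
  assumes "p \<in> lists S" "p \<noteq> []" "distinct_adj p"
  shows "word_val W (butlast p) \<in> carrier W" "last p \<in> S"
    "halfspace p = word_val W (butlast p) <#\<^bsub>W\<^esub> simple_root W S (last p)"
proof -
  have "butlast p @ [last p] = p" using assms by simp
  moreover have "butlast p \<in> lists S" using assms by (auto simp: in_lists_conv_set dest: in_set_butlastD)
  moreover show "last p \<in> S" using assms by (auto simp: in_lists_conv_set)
  ultimately show "word_val W (butlast p) \<in> carrier W"
    "halfspace p = word_val W (butlast p) <#\<^bsub>W\<^esub> simple_root W S (last p)"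
    using halfspace_eq_l_coset[of "butlast p" "last p"] assms(3) by auto
qed

lemma root_u_halfspace:
  "p \<in> lists S \<Longrightarrow> p \<noteq> [] \<Longrightarrow> distinct_adj p \<Longrightarrow> root_u (halfspace p) = word_u p"
  by (simp add: halfspace_decomp root_u_l_coset word_u_def)

lemma halfspace_root: "p \<in> lists S \<Longrightarrow> p \<noteq> [] \<Longrightarrow> distinct_adj p \<Longrightarrow> halfspace p \<in> roots W S"
  using halfspace_decomp unfolding roots_def by blast

lemma halfspace_pos_root: "p \<in> lists S \<Longrightarrow> p \<noteq> [] \<Longrightarrow> distinct_adj p \<Longrightarrow> halfspace p \<in> pos_roots W S"
  by (simp add: pos_roots_def halfspace_root) (simp add: halfspace_def)

lemma pos_root_halfspace:
  assumes "\<alpha> \<in> pos_roots W S"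
  obtains p where "p \<in> lists S" "p \<noteq> []" "distinct_adj p" "\<alpha> = halfspace p"
proof -
  obtain v s where v: "v \<in> carrier W" "s \<in> S" "\<alpha> = v <#\<^bsub>W\<^esub> simple_root W S s"
    using assms unfolding pos_roots_def roots_def by blast
  then have "\<alpha> = halfspace (nf v @ [s])" "distinct_adj (nf v @ [s])"
    using positive_root_halfspace[of v s] assms by (auto simp: pos_roots_def)
  then show ?thesis using that[of "nf v @ [s]"] v nf_in_lists by auto
qed

lemma U_subset: "\<alpha> \<in> roots W S \<Longrightarrow> U \<alpha> \<subseteq> carrier G"
  by (auto simp: U_def)

lemma conj_U:
  assumes "g \<in> carrier G" "\<alpha> \<in> roots W S"
  shows "g <#\<^bsub>G\<^esub> U \<alpha> #>\<^bsub>G\<^esub> inv\<^bsub>G\<^esub> g = {\<one>\<^bsub>G\<^esub>, g \<otimes>\<^bsub>G\<^esub> root_u \<alpha> \<otimes>\<^bsub>G\<^esub> inv\<^bsub>G\<^esub> g}"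
  using assms by (auto simp: l_coset_def r_coset_def U_def)

lemma conj_U_eq_iff:
  assumes "g \<in> carrier G" "\<alpha> \<in> roots W S" "\<beta> \<in> roots W S"
  shows "g <#\<^bsub>G\<^esub> U \<alpha> #>\<^bsub>G\<^esub> inv\<^bsub>G\<^esub> g = U \<beta> \<longleftrightarrow> g \<otimes>\<^bsub>G\<^esub> root_u \<alpha> \<otimes>\<^bsub>G\<^esub> inv\<^bsub>G\<^esub> g = root_u \<beta>"
  using conj_U[OF assms(1,2)] root_u_nontrivial[OF assms(2)] root_u_nontrivial[OF assms(3)]
   G.conj_one_iff[OF assms(1) root_u_closed[OF assms(2)]]
  by (auto simp: U_def doubleton_eq_iff)

text \<open>An element of \<open>N\<close> represents \<open>w\<close> iff it permutes the root elements as \<open>w\<close> permutes the roots.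
  This describes both \<open>H\<close>, which induces \<open>1\<close>, and the isomorphism from \<open>N/H\<close> onto \<open>W\<close>.\<close>

definition induces :: "'g \<Rightarrow> 'a \<Rightarrow> bool" where
  "induces g w \<longleftrightarrow> (\<forall>\<alpha>\<in>roots W S. g \<otimes>\<^bsub>G\<^esub> root_u \<alpha> \<otimes>\<^bsub>G\<^esub> inv\<^bsub>G\<^esub> g = root_u (w <#\<^bsub>W\<^esub> \<alpha>))"

abbreviation "H \<equiv> rgd_H W S G U"
abbreviation "N \<equiv> rgd_N W S G U"
abbreviation "B \<equiv> rgd_B W S G U"

lemma H_iff: "g \<in> H \<longleftrightarrow> g \<in> carrier G \<and> induces g \<one>\<^bsub>W\<^esub>"
proof -
  have "g \<in> normalizer G (U \<alpha>) \<longleftrightarrow> g \<otimes>\<^bsub>G\<^esub> root_u \<alpha> \<otimes>\<^bsub>G\<^esub> inv\<^bsub>G\<^esub> g = root_u \<alpha>"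
    if "g \<in> carrier G" "\<alpha> \<in> roots W S" for \<alpha>
    using conj_U_eq_iff[OF that that(2)] U_subset[OF that(2)] that(1)
    by (simp add: normalizer_def stabilizer_def)
  then show ?thesis
    by (auto simp: rgd_H_def induces_def W.lcos_mult_one root_carrier)
qed

lemma induces_m: "w \<in> carrier W \<Longrightarrow> induces (m w) w"
  by (simp add: induces_def root_u_translate)

lemma induces_mult:
  assumes "g \<in> carrier G" "h \<in> carrier G" "v \<in> carrier W" "w \<in> carrier W" "induces g v" "induces h w"
  shows "induces (g \<otimes>\<^bsub>G\<^esub> h) (v \<otimes>\<^bsub>W\<^esub> w)"
  unfolding induces_def
proof
  fix \<alpha> assume a: "\<alpha> \<in> roots W S"
  have "(g \<otimes>\<^bsub>G\<^esub> h) \<otimes>\<^bsub>G\<^esub> root_u \<alpha> \<otimes>\<^bsub>G\<^esub> inv\<^bsub>G\<^esub> (g \<otimes>\<^bsub>G\<^esub> h) = root_u (v <#\<^bsub>W\<^esub> (w <#\<^bsub>W\<^esub> \<alpha>))"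
    using assms a by (simp add: G.conj_conj[symmetric] induces_def root_translate)
  then show "(g \<otimes>\<^bsub>G\<^esub> h) \<otimes>\<^bsub>G\<^esub> root_u \<alpha> \<otimes>\<^bsub>G\<^esub> inv\<^bsub>G\<^esub> (g \<otimes>\<^bsub>G\<^esub> h) = root_u ((v \<otimes>\<^bsub>W\<^esub> w) <#\<^bsub>W\<^esub> \<alpha>)"
    using assms a by (simp add: W.lcos_m_assoc root_carrier)
qed

lemma induces_inv:
  assumes "g \<in> carrier G" "v \<in> carrier W" "induces g v"
  shows "induces (inv\<^bsub>G\<^esub> g) (inv\<^bsub>W\<^esub> v)"
  unfolding induces_def
proof
  fix \<alpha> assume a: "\<alpha> \<in> roots W S"
  let ?\<beta> = "inv\<^bsub>W\<^esub> v <#\<^bsub>W\<^esub> \<alpha>"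
  have b: "?\<beta> \<in> roots W S" using assms a by (simp add: root_translate)
  have "g \<otimes>\<^bsub>G\<^esub> root_u ?\<beta> \<otimes>\<^bsub>G\<^esub> inv\<^bsub>G\<^esub> g = root_u (v <#\<^bsub>W\<^esub> ?\<beta>)"
    using assms b by (simp add: induces_def)
  also have "v <#\<^bsub>W\<^esub> ?\<beta> = \<alpha>"
    using l_coset_inverse_cancel assms a root_carrier by blast
  finally have "root_u \<alpha> = g \<otimes>\<^bsub>G\<^esub> root_u ?\<beta> \<otimes>\<^bsub>G\<^esub> inv\<^bsub>G\<^esub> g" by simp
  then show "inv\<^bsub>G\<^esub> g \<otimes>\<^bsub>G\<^esub> root_u \<alpha> \<otimes>\<^bsub>G\<^esub> inv\<^bsub>G\<^esub> (inv\<^bsub>G\<^esub> g) = root_u ?\<beta>"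
    using G.conj_conj[of "inv\<^bsub>G\<^esub> g" g "root_u ?\<beta>"] assms(1) b by simp
qed

text \<open>With \<open>v = m\<^sub>s u\<^sub>s m\<^sub>s\<close>, the braid relation gives \<open>m\<^sub>s = v u\<^sub>s v\<close>.\<close>

lemma is_m_m:
  assumes "s \<in> S"
  shows "is_m W S G U s (u s) (m s)"
proof -
  have uc: "u s \<in> carrier G" "m s \<in> carrier G"
    using assms by (simp_all add: u_closed S_carrier)
  have c: "m s \<otimes>\<^bsub>G\<^esub> (m s \<otimes>\<^bsub>G\<^esub> z) = z" "u s \<otimes>\<^bsub>G\<^esub> (u s \<otimes>\<^bsub>G\<^esub> z) = z" if "z \<in> carrier G" for z
    using that assms uc by (simp_all add: G.m_assoc[symmetric] m_S_square u_involution)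
  have "m s = (m s \<otimes>\<^bsub>G\<^esub> u s \<otimes>\<^bsub>G\<^esub> m s) \<otimes>\<^bsub>G\<^esub> u s \<otimes>\<^bsub>G\<^esub> (m s \<otimes>\<^bsub>G\<^esub> u s \<otimes>\<^bsub>G\<^esub> m s)"
    using uc c by (subst braid[OF assms, symmetric], simp add: G.m_assoc)
  moreover have "\<forall>\<beta>\<in>roots W S. m s <#\<^bsub>G\<^esub> U \<beta> #>\<^bsub>G\<^esub> inv\<^bsub>G\<^esub> (m s) = U (s <#\<^bsub>W\<^esub> \<beta>)"
    using assms by (simp add: conj_U_eq_iff S_carrier root_translate root_u_translate)
  moreover have "m s \<otimes>\<^bsub>G\<^esub> u s \<otimes>\<^bsub>G\<^esub> m s \<in> U (opp W (simple_root W S s))"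
    using root_u_opp_simple[OF assms] by (simp add: U_def)
  ultimately show ?thesis
    unfolding is_m_def by (intro conjI bexI[of _ "m s \<otimes>\<^bsub>G\<^esub> u s \<otimes>\<^bsub>G\<^esub> m s"])
qed

lemma is_m_induces:
  assumes "s \<in> S" "is_m W S G U s x n" "x \<in> U (simple_root W S s)"
  shows "n \<in> carrier G" "induces n s"
proof -
  obtain y z where yz: "y \<in> U (opp W (simple_root W S s))" "z \<in> U (opp W (simple_root W S s))"
    "n = y \<otimes>\<^bsub>G\<^esub> x \<otimes>\<^bsub>G\<^esub> z"
    using assms(2) unfolding is_m_def by blast
  have "y \<in> carrier G" "z \<in> carrier G" "x \<in> carrier G"
    using yz(1,2) assms(3) U_subset[OF opp_simple_root_root[OF assms(1)]]
      U_subset[OF simple_root_root[OF assms(1)]] by blast+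
  then show n: "n \<in> carrier G" by (simp add: yz(3))
  show "induces n s"
    unfolding induces_def
  proof
    fix \<beta> assume b: "\<beta> \<in> roots W S"
    then have "s <#\<^bsub>W\<^esub> \<beta> \<in> roots W S" using assms(1) root_translate S_carrier by blast
    then show "n \<otimes>\<^bsub>G\<^esub> root_u \<beta> \<otimes>\<^bsub>G\<^esub> inv\<^bsub>G\<^esub> n = root_u (s <#\<^bsub>W\<^esub> \<beta>)"
      using assms(2) b conj_U_eq_iff[OF n b] unfolding is_m_def by blast
  qed
qed

lemma N_generators:
  "rgd_H W S G U \<union> {n. \<exists>s\<in>S. \<exists>x\<in>U (simple_root W S s) - {\<one>\<^bsub>G\<^esub>}. is_m W S G U s x n} \<subseteq> carrier G"
  using is_m_induces(1) by (auto simp: H_iff)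

lemma subgroup_N: "subgroup N G"
  unfolding rgd_N_def by (rule G.generate_is_subgroup[OF N_generators])

lemma H_subset_N: "H \<subseteq> N"
  unfolding rgd_N_def by (auto intro: generate.incl)

lemma m_in_N: "w \<in> carrier W \<Longrightarrow> m w \<in> N"
proof -
  assume "w \<in> carrier W"
  then obtain ws where "ws \<in> lists S" "w = word_val W ws"
    using carrier_word_val by blast
  moreover have "ws \<in> lists S \<Longrightarrow> m (word_val W ws) \<in> N"
  proof (induction ws)
    case Nil
    then show ?case using subgroup.one_closed[OF subgroup_N] by (simp add: m_one)
  next
    case (Cons s ws)
    then have s: "s \<in> S" by simp
    then have "u s \<in> U (simple_root W S s) - {\<one>\<^bsub>G\<^esub>}"
      by (simp add: U_def root_u_simple u_nontrivial)
    then have "m s \<in> N"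
      unfolding rgd_N_def using is_m_m[OF s] s by (intro generate.incl) blast
    then show ?case
      using Cons subgroup.m_closed[OF subgroup_N] by (simp add: m_mult S_carrier)
  qed
  ultimately show ?thesis by blast
qed

lemma N_induces:
  assumes "n \<in> N"
  shows "n \<in> carrier G \<and> (\<exists>w\<in>carrier W. induces n w)"
proof -
  have generator: "h \<in> carrier G \<and> (\<exists>w\<in>carrier W. induces h w)"
    if "h \<in> H \<union> {n. \<exists>s\<in>S. \<exists>x\<in>U (simple_root W S s) - {\<one>\<^bsub>G\<^esub>}. is_m W S G U s x n}" for h
  proof (cases "h \<in> H")
    case True
    then show ?thesis using H_iff W.one_closed by blast
  next
    case False
    with that obtain s x where "s \<in> S" "x \<in> U (simple_root W S s)" "is_m W S G U s x h" by blast
    then show ?thesis using is_m_induces[of s x h] S_carrier by blast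
  qed
  show ?thesis
    using assms unfolding rgd_N_def
  proof (induction rule: generate.induct)
    case one
    then show ?case using induces_m[of "\<one>\<^bsub>W\<^esub>"] by (auto simp: m_one)
  next
    case (incl h)
    then show ?case using generator by blast
  next
    case (inv h)
    then have "h \<in> carrier G" "\<exists>w\<in>carrier W. induces h w"
      using generator by blast+
    then show ?case using induces_inv by auto
  next
    case (eng h1 h2)
    then show ?case using induces_mult by (meson G.m_closed W.m_closed)
  qed
qed

end


section \<open>The fundamental chamber and the Weyl group\<close>

text \<open>The stabiliser of the base point contains \<open>U\<^sub>+\<close>, which gives (RGD3), and the relations are stated only for
  positive roots, where they are relations between words; translation by \<open>W\<close> turns them into (RGD1).\<close>

locale rgd_action_relations = rgd_action W S G m u act x0
  for W :: "('a, 'b) monoid_scheme" and S and G :: "('g, 'h) monoid_scheme"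
    and m :: "'a \<Rightarrow> 'g" and u :: "'a \<Rightarrow> 'g" and act :: "'g \<Rightarrow> 'x \<Rightarrow> 'x" and x0 :: 'x +
  assumes act_pos: "p \<in> lists S \<Longrightarrow> p \<noteq> [] \<Longrightarrow> distinct_adj p \<Longrightarrow> act (word_u p) x0 = x0"
    and commutator: "p @ q \<in> lists S \<Longrightarrow> p \<noteq> [] \<Longrightarrow> q \<noteq> [] \<Longrightarrow> distinct_adj (p @ q) \<Longrightarrow>
      word_u p \<otimes>\<^bsub>G\<^esub> word_u (p @ q) \<otimes>\<^bsub>G\<^esub> word_u p \<otimes>\<^bsub>G\<^esub> word_u (p @ q) = \<one>\<^bsub>G\<^esub> \<or>
      (\<exists>r. strict_prefix p r \<and> strict_prefix r (p @ q) \<and>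
        word_u p \<otimes>\<^bsub>G\<^esub> word_u (p @ q) \<otimes>\<^bsub>G\<^esub> word_u p \<otimes>\<^bsub>G\<^esub> word_u (p @ q) = word_u r)"
begin

lemma act_pos_root: "\<alpha> \<in> pos_roots W S \<Longrightarrow> act (root_u \<alpha>) x0 = x0"
  by (elim pos_root_halfspace) (simp add: root_u_halfspace act_pos)

lemma U_plus_fixes:
  assumes "g \<in> rgd_U_plus W S G U"
  shows "g \<in> carrier G \<and> act g x0 = x0"
  using assms unfolding rgd_U_plus_def
proof (induction rule: generate.induct)
  case one
  show ?case by (simp add: act_one)
next
  case (incl h)
  then obtain \<alpha> where "\<alpha> \<in> pos_roots W S" "h \<in> U \<alpha>" by blast
  moreover from this have "\<alpha> \<in> roots W S" by (simp add: pos_roots_def)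
  ultimately show ?case
    using act_pos_root by (auto simp: U_def act_one)
next
  case (inv h)
  then obtain \<alpha> where "\<alpha> \<in> pos_roots W S" "h \<in> U \<alpha>" by blast
  moreover from this have "\<alpha> \<in> roots W S" by (simp add: pos_roots_def)
  ultimately show ?case
    using act_pos_root by (auto simp: U_def act_one root_u_inv)
next
  case (eng h1 h2)
  then show ?case by (simp add: act_mult)
qed

text \<open>\<open>H\<close> centralises the \<open>u s\<close>, so it permutes their common fixed points.\<close>

lemma H_fixes:
  assumes "h \<in> H"
  shows "act h x0 = x0"
proof (rule fixed_point_unique)
  show h: "h \<in> carrier G" using assms H_iff by blast
  fix s assume s: "s \<in> S"
  have "h \<otimes>\<^bsub>G\<^esub> u s \<otimes>\<^bsub>G\<^esub> inv\<^bsub>G\<^esub> h = u s"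
    using assms s simple_root_root[OF s]
    by (auto simp: H_iff induces_def root_u_simple W.lcos_mult_one simple_root_carrier)
  then have "h \<otimes>\<^bsub>G\<^esub> u s = u s \<otimes>\<^bsub>G\<^esub> h"
    using h s u_closed G.inv_solve_right'[of "u s" "h \<otimes>\<^bsub>G\<^esub> u s" h] by simp
  then have "act (u s) (act h x0) = act h (act (u s) x0)"
    using h s u_closed act_mult by metis
  moreover have "act (u s) x0 = x0"
    using act_pos[of "[s]"] s by (simp add: word_u_def conj_u_def m_one u_closed)
  ultimately show "act (u s) (act h x0) = act h x0" by simp
qed

lemma B_fixes: "g \<in> B \<Longrightarrow> g \<in> carrier G \<and> act g x0 = x0"
  using H_fixes U_plus_fixes H_iff by (auto simp: rgd_B_def set_mult_def act_mult)

text \<open>If \<open>g\<close> induces two elements, then some \<open>z \<noteq> 1\<close> leaves all root elements unchanged. Let \<open>s\<close> be the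
  first letter of \<open>z\<close>. Then \<open>z\<close> maps a positive root to \<open>-\<alpha>\<^sub>s\<close>, although the root element of
  the former fixes the base point and that of the latter moves it.\<close>

lemma induces_unique:
  assumes "v \<in> carrier W" "w \<in> carrier W" "induces g v" "induces g w"
  shows "v = w"
proof (rule ccontr)
  assume "v \<noteq> w"
  define z where "z = inv\<^bsub>W\<^esub> v \<otimes>\<^bsub>W\<^esub> w"
  have z: "z \<in> carrier W" "z \<noteq> \<one>\<^bsub>W\<^esub>"
    using assms \<open>v \<noteq> w\<close> W.inv_solve_left'[of "\<one>\<^bsub>W\<^esub>" v w] by (auto simp: z_def)
  have fixed: "root_u (z <#\<^bsub>W\<^esub> \<alpha>) = root_u \<alpha>" if a: "\<alpha> \<in> roots W S" for \<alpha>
  proof -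
    have "root_u (w <#\<^bsub>W\<^esub> \<alpha>) = root_u (v <#\<^bsub>W\<^esub> \<alpha>)"
      using assms(3,4) a by (simp add: induces_def)
    then have "root_u (inv\<^bsub>W\<^esub> v <#\<^bsub>W\<^esub> (w <#\<^bsub>W\<^esub> \<alpha>)) = root_u (inv\<^bsub>W\<^esub> v <#\<^bsub>W\<^esub> (v <#\<^bsub>W\<^esub> \<alpha>))"
      using root_u_translate[of "inv\<^bsub>W\<^esub> v"] assms(1,2) a root_translate by (metis W.inv_closed)
    then show ?thesis
      using assms(1,2) a by (simp add: z_def W.lcos_m_assoc root_carrier W.lcos_mult_one)
  qed
  obtain s ws where s: "nf z = s # ws"
    using z word_val_nf[OF z(1)] by (cases "nf z") auto
  then have S: "s \<in> S" using nf_in_lists[OF z(1)] by simp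
  let ?\<beta> = "s <#\<^bsub>W\<^esub> simple_root W S s"
  let ?\<alpha> = "inv\<^bsub>W\<^esub> z <#\<^bsub>W\<^esub> ?\<beta>"
  have b: "?\<beta> \<in> roots W S" using S root_translate S_carrier simple_root_root by blast
  have a: "?\<alpha> \<in> roots W S" using b z root_translate by blast
  have "\<one>\<^bsub>W\<^esub> \<in> ?\<alpha> \<longleftrightarrow> s \<otimes>\<^bsub>W\<^esub> z \<in> simple_root W S s"
    using z S root_carrier[OF b] simple_root_carrier
    by (simp add: mem_l_coset_iff S_carrier S_inv)
  also have "\<dots> \<longleftrightarrow> \<not> prefix [s] ws"
    using z S s by (simp add: simple_root_halfspace halfspace_def nf_mult S_carrier)
  also have "\<dots>" using distinct_adj_nf[OF z(1)] s by (cases ws) auto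
  finally have "?\<alpha> \<in> pos_roots W S" using a by (simp add: pos_roots_def)
  then have "act (root_u ?\<alpha>) x0 = x0" by (rule act_pos_root)
  moreover have "z <#\<^bsub>W\<^esub> ?\<alpha> = ?\<beta>"
    using l_coset_inverse_cancel z root_carrier[OF b] by blast
  ultimately have "act (root_u ?\<beta>) x0 = x0" using fixed[OF a] by simp
  then show False
    using moved[OF S] root_u_opp_simple[OF S] opp_simple_root[OF S] by simp
qed

definition weyl :: "'g \<Rightarrow> 'a" where
  "weyl n = (THE w. w \<in> carrier W \<and> induces n w)"

lemma weyl_eq: "w \<in> carrier W \<Longrightarrow> induces n w \<Longrightarrow> weyl n = w"
  unfolding weyl_def using induces_unique by blast

lemma one_in_H: "\<one>\<^bsub>G\<^esub> \<in> H"
  using induces_m[of "\<one>\<^bsub>W\<^esub>"] by (simp add: H_iff m_one)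

lemma weyl_coset:
  assumes "n \<in> carrier G" "w \<in> carrier W" "induces n w"
  shows "the_elem (weyl ` (H #>\<^bsub>G\<^esub> n)) = w"
proof -
  have "weyl (h \<otimes>\<^bsub>G\<^esub> n) = w" if "h \<in> H" for h
    using that assms induces_mult[of h n "\<one>\<^bsub>W\<^esub>" w] by (auto simp: H_iff weyl_eq)
  then have "weyl ` (H #>\<^bsub>G\<^esub> n) = {w}"
    using one_in_H by (force simp: r_coset_def)
  then show ?thesis by simp
qed

lemma is_weyl_iso: "is_weyl_iso W S G U (\<lambda>C. the_elem (weyl ` C))"
proof -
  let ?N = "G\<lparr>carrier := N\<rparr>"
  have N: "group ?N" using G.subgroup_imp_group[OF subgroup_N] .
  have hom: "weyl \<in> hom ?N W"
  proof (rule homI)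
    fix x assume "x \<in> carrier ?N"
    then show "weyl x \<in> carrier W" using N_induces weyl_eq by fastforce
  next
    fix x y assume "x \<in> carrier ?N" "y \<in> carrier ?N"
    then obtain v w where v: "x \<in> carrier G" "v \<in> carrier W" "induces x v"
      "y \<in> carrier G" "w \<in> carrier W" "induces y w"
      using N_induces[of x] N_induces[of y] by auto
    then show "weyl (x \<otimes>\<^bsub>?N\<^esub> y) = weyl x \<otimes>\<^bsub>W\<^esub> weyl y"
      using induces_mult[of x y v w] by (simp add: weyl_eq)
  qed
  have weyl_hom: "group_hom ?N W weyl"
    using N hom by (simp add: group_hom_def group_hom_axioms_def W.is_group)
  have kernel: "kernel ?N W weyl = H"
  proof -
    have "x \<in> H" if "x \<in> N" "weyl x = \<one>\<^bsub>W\<^esub>" for x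
      using N_induces[OF that(1)] that(2) weyl_eq by (auto simp: H_iff)
    moreover have "x \<in> N \<and> weyl x = \<one>\<^bsub>W\<^esub>" if "x \<in> H" for x
      using that H_subset_N weyl_eq H_iff by auto
    ultimately show ?thesis by (auto simp: kernel_def)
  qed
  have "weyl ` carrier ?N = carrier W"
  proof
    show "weyl ` carrier ?N \<subseteq> carrier W" by (auto intro: group_hom.hom_closed[OF weyl_hom])
    show "carrier W \<subseteq> weyl ` carrier ?N"
    proof
      fix w assume "w \<in> carrier W"
      then show "w \<in> weyl ` carrier ?N"
        using m_in_N weyl_eq[OF _ induces_m] by (force intro: rev_image_eqI)
    qed
  qed
  then have iso: "(\<lambda>C. the_elem (weyl ` C)) \<in> iso (?N Mod H) W"
    using group_hom.FactGroup_iso_set[OF weyl_hom] kernel by simp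
  show ?thesis
    unfolding is_weyl_iso_def using iso weyl_coset is_m_induces S_carrier by blast
qed


section \<open>The RGD-system and the failure of (FPRS)\<close>

text \<open>The relations are given for positive roots; left translation carries them to all pairs of
  nested roots.\<close>

lemma nested_commutator:
  assumes x: "x \<in> carrier W" and pq: "p @ q \<in> lists S" "p \<noteq> []" "q \<noteq> []" "distinct_adj (p @ q)"
    and \<alpha>: "\<alpha> = x <#\<^bsub>W\<^esub> halfspace p" and \<beta>: "\<beta> = x <#\<^bsub>W\<^esub> halfspace (p @ q)"
  shows "root_u \<alpha> \<otimes>\<^bsub>G\<^esub> root_u \<beta> \<otimes>\<^bsub>G\<^esub> root_u \<alpha> \<otimes>\<^bsub>G\<^esub> root_u \<beta>
    \<in> {\<one>\<^bsub>G\<^esub>} \<union> root_u ` open_root_interval W S \<alpha> \<beta>"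
proof -
  have prefix_reduced: "r \<in> lists S \<and> distinct_adj r" if "prefix r (p @ q)" for r
    using that pq(1,4) distinct_adj_append_iff[of r] append_in_lists_conv[of r _ S]
    by (metis prefix_def)
  have word_u_conj: "word_u r \<in> carrier G \<and> halfspace r \<in> roots W S \<and>
      root_u (x <#\<^bsub>W\<^esub> halfspace r) = m x \<otimes>\<^bsub>G\<^esub> word_u r \<otimes>\<^bsub>G\<^esub> inv\<^bsub>G\<^esub> (m x)"
    if "prefix r (p @ q)" "r \<noteq> []" for r
  proof -
    have r: "r \<in> lists S" "r \<noteq> []" "distinct_adj r" using prefix_reduced that by auto
    show ?thesis
      using root_u_translate[OF x halfspace_root[OF r]] root_u_closed[OF halfspace_root[OF r]]
        root_u_halfspace[OF r] halfspace_root[OF r] by simp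
  qed
  have p: "prefix p (p @ q)" and pq': "prefix (p @ q) (p @ q)" "p @ q \<noteq> []" using pq by auto
  note wp = word_u_conj[OF p pq(2)] and wpq = word_u_conj[OF pq']
  define c where "c = word_u p \<otimes>\<^bsub>G\<^esub> word_u (p @ q) \<otimes>\<^bsub>G\<^esub> word_u p \<otimes>\<^bsub>G\<^esub> word_u (p @ q)"
  have conj: "root_u \<alpha> \<otimes>\<^bsub>G\<^esub> root_u \<beta> \<otimes>\<^bsub>G\<^esub> root_u \<alpha> \<otimes>\<^bsub>G\<^esub> root_u \<beta> = m x \<otimes>\<^bsub>G\<^esub> c \<otimes>\<^bsub>G\<^esub> inv\<^bsub>G\<^esub> (m x)"
    using wp wpq x by (simp add: \<alpha> \<beta> c_def G.conj_mult)
  from commutator[OF pq] consider "c = \<one>\<^bsub>G\<^esub>"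
    | r where "strict_prefix p r" "strict_prefix r (p @ q)" "c = word_u r"
    unfolding c_def by blast
  then show ?thesis
  proof cases
    case 1
    then show ?thesis unfolding conj using x by simp
  next
    case 2
    define \<gamma> where "\<gamma> = x <#\<^bsub>W\<^esub> halfspace r"
    have r: "prefix r (p @ q)" "r \<noteq> []" using 2 pq by (auto simp: strict_prefix_def)
    have sub: "x <#\<^bsub>W\<^esub> halfspace a \<subseteq> x <#\<^bsub>W\<^esub> halfspace b \<longleftrightarrow> prefix a b"
      if "prefix a (p @ q)" "prefix b (p @ q)" for a b
      using l_coset_inj[OF x halfspace_carrier halfspace_carrier, of a b] halfspace_subset_iff[of a b]
        prefix_reduced[OF that(1)] prefix_reduced[OF that(2)] by simp
    have incl: "\<alpha> \<subseteq> \<gamma>" "\<gamma> \<subseteq> \<beta>" "\<not> \<gamma> \<subseteq> \<alpha>" "\<not> \<beta> \<subseteq> \<gamma>"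
      unfolding \<alpha> \<beta> \<gamma>_def sub[OF p r(1)] sub[OF r(1) pq'(1)] sub[OF r(1) p] sub[OF pq'(1) r(1)]
      using 2 by (auto dest: prefix_order.antisym)
    have "\<gamma> \<in> roots W S"
      using root_translate x word_u_conj[OF r] unfolding \<gamma>_def by blast
    with incl have "\<gamma> \<in> open_root_interval W S \<alpha> \<beta>"
      by (auto simp: open_root_interval_def closed_root_interval_def opp_def)
    then show ?thesis
      unfolding conj 2(3) using word_u_conj[OF r] unfolding \<gamma>_def by (metis UnI2 imageI)
  qed
qed

lemma open_root_interval_commute: "open_root_interval W S \<alpha> \<beta> = open_root_interval W S \<beta> \<alpha>"
  by (auto simp: open_root_interval_def closed_root_interval_def)

text \<open>A common element \<open>x\<close> of the two roots is moved to \<open>1\<close>, which makes both positive. A common element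
  of their complements then has both words as prefixes, so one word extends the other. If \<open>\<beta>\<close> lies
  inside \<open>\<alpha>\<close>, the commutator is the inverse of the one in \<open>nested_commutator\<close>, which is its own inverse.\<close>

lemma prenilpotent_commutator:
  assumes \<alpha>: "\<alpha> \<in> roots W S" and \<beta>: "\<beta> \<in> roots W S" and "prenilpotent W \<alpha> \<beta>" "\<alpha> \<noteq> \<beta>"
  shows "root_u \<alpha> \<otimes>\<^bsub>G\<^esub> root_u \<beta> \<otimes>\<^bsub>G\<^esub> root_u \<alpha> \<otimes>\<^bsub>G\<^esub> root_u \<beta>
    \<in> {\<one>\<^bsub>G\<^esub>} \<union> root_u ` open_root_interval W S \<alpha> \<beta>"
proof -
  obtain x z where xz: "x \<in> \<alpha>" "x \<in> \<beta>" "z \<in> carrier W" "z \<notin> \<alpha>" "z \<notin> \<beta>"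
    using assms by (auto simp: prenilpotent_def opp_def)
  then have x: "x \<in> carrier W" using \<alpha> root_carrier by blast
  have translate: "\<exists>p. p \<in> lists S \<and> p \<noteq> [] \<and> distinct_adj p \<and> \<gamma> = x <#\<^bsub>W\<^esub> halfspace p \<and>
      prefix p (nf (inv\<^bsub>W\<^esub> x \<otimes>\<^bsub>W\<^esub> z))"
    if \<gamma>: "\<gamma> \<in> roots W S" "x \<in> \<gamma>" "z \<notin> \<gamma>" for \<gamma>
  proof -
    have "inv\<^bsub>W\<^esub> x <#\<^bsub>W\<^esub> \<gamma> \<in> pos_roots W S"
      using \<gamma> x root_translate[of "inv\<^bsub>W\<^esub> x" \<gamma>] root_carrier[OF \<gamma>(1)]
      by (simp add: pos_roots_def mem_l_coset_iff)
    then obtain p where p: "p \<in> lists S" "p \<noteq> []" "distinct_adj p" "inv\<^bsub>W\<^esub> x <#\<^bsub>W\<^esub> \<gamma> = halfspace p"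
      by (elim pos_root_halfspace)
    then have \<gamma>_eq: "\<gamma> = x <#\<^bsub>W\<^esub> halfspace p"
      using l_coset_inverse_cancel[OF x root_carrier[OF \<gamma>(1)]] by simp
    then have "inv\<^bsub>W\<^esub> x \<otimes>\<^bsub>W\<^esub> z \<notin> halfspace p"
      using \<gamma>(3) mem_l_coset_iff[OF x halfspace_carrier xz(3)] by simp
    then have "prefix p (nf (inv\<^bsub>W\<^esub> x \<otimes>\<^bsub>W\<^esub> z))"
      using x xz(3) by (simp add: halfspace_def)
    then show ?thesis using p \<gamma>_eq by blast
  qed
  obtain p where p: "p \<in> lists S" "p \<noteq> []" "distinct_adj p" "\<alpha> = x <#\<^bsub>W\<^esub> halfspace p"
      "prefix p (nf (inv\<^bsub>W\<^esub> x \<otimes>\<^bsub>W\<^esub> z))"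
    using translate[OF \<alpha> xz(1,4)] by blast
  obtain p' where p': "p' \<in> lists S" "p' \<noteq> []" "distinct_adj p'" "\<beta> = x <#\<^bsub>W\<^esub> halfspace p'"
      "prefix p' (nf (inv\<^bsub>W\<^esub> x \<otimes>\<^bsub>W\<^esub> z))"
    using translate[OF \<beta> xz(2,5)] by blast
  have "p \<noteq> p'" using p p' \<open>\<alpha> \<noteq> \<beta>\<close> by blast
  then consider q where "p' = p @ q" "q \<noteq> []" | q where "p = p' @ q" "q \<noteq> []"
    using prefix_same_cases[OF p(5) p'(5)] by (auto simp: prefix_def)
  then show ?thesis
  proof cases
    case 1
    then show ?thesis
      using nested_commutator[OF x _ p(2) _ _ p(4)] p' by blast
  next
    case 2
    let ?a = "root_u \<alpha>" and ?b = "root_u \<beta>"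
    have ba: "?b \<otimes>\<^bsub>G\<^esub> ?a \<otimes>\<^bsub>G\<^esub> ?b \<otimes>\<^bsub>G\<^esub> ?a \<in> {\<one>\<^bsub>G\<^esub>} \<union> root_u ` open_root_interval W S \<beta> \<alpha>"
      using 2 nested_commutator[OF x _ p'(2) _ _ p'(4)] p by blast
    have "?a \<otimes>\<^bsub>G\<^esub> ?b \<otimes>\<^bsub>G\<^esub> ?a \<otimes>\<^bsub>G\<^esub> ?b = inv\<^bsub>G\<^esub> (?b \<otimes>\<^bsub>G\<^esub> ?a \<otimes>\<^bsub>G\<^esub> ?b \<otimes>\<^bsub>G\<^esub> ?a)"
      using \<alpha> \<beta> by (simp add: G.inv_mult_group root_u_inv G.m_assoc)
    also have "\<dots> = ?b \<otimes>\<^bsub>G\<^esub> ?a \<otimes>\<^bsub>G\<^esub> ?b \<otimes>\<^bsub>G\<^esub> ?a"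
      using ba root_u_inv by (auto simp: open_root_interval_def closed_root_interval_def)
    finally show ?thesis using ba open_root_interval_commute by simp
  qed
qed

lemma generated_by_root_groups: "carrier G = generate G (\<Union>\<alpha>\<in>roots W S. U \<alpha>)"
proof
  have sub: "(\<Union>\<alpha>\<in>roots W S. U \<alpha>) \<subseteq> carrier G" using U_subset by blast
  then show "generate G (\<Union>\<alpha>\<in>roots W S. U \<alpha>) \<subseteq> carrier G" by (rule G.generate_incl)
  let ?K = "generate G (\<Union>\<alpha>\<in>roots W S. U \<alpha>)"
  have K: "subgroup ?K G" by (rule G.generate_is_subgroup[OF sub])
  have "u s \<in> ?K \<and> m s \<in> ?K" if s: "s \<in> S" for s
  proof -
    have "root_u \<alpha> \<in> ?K" if "\<alpha> \<in> roots W S" for \<alpha>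
      using that by (intro generate.incl) (auto simp: U_def)
    from this[OF simple_root_root[OF s]] this[OF opp_simple_root_root[OF s]]
    have us: "u s \<in> ?K" and v: "m s \<otimes>\<^bsub>G\<^esub> u s \<otimes>\<^bsub>G\<^esub> m s \<in> ?K"
      using s by (simp_all add: root_u_simple root_u_opp_simple)
    obtain y z where "y \<in> U (opp W (simple_root W S s))" "z \<in> U (opp W (simple_root W S s))"
        "m s = y \<otimes>\<^bsub>G\<^esub> u s \<otimes>\<^bsub>G\<^esub> z"
      using is_m_m[OF s] unfolding is_m_def by blast
    then have "m s \<in> ?K"
      using us opp_simple_root_root[OF s] subgroup.m_closed[OF K] generate.incl[of _ "\<Union>\<alpha>\<in>roots W S. U \<alpha>" G]
      by (metis UN_I)
    then show ?thesis using us by blast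
  qed
  then have "u ` S \<union> m ` S \<subseteq> ?K" by blast
  then have "generate G (u ` S \<union> m ` S) \<subseteq> ?K"
    by (rule G.generate_subgroup_incl[OF _ K])
  then show "carrier G \<subseteq> ?K" using generated by simp
qed

lemma RGD_system: "RGD_system W S G U"
  unfolding RGD_system_def
proof (intro conjI ballI impI)
  show "group G" by (rule G.is_group)
next
  fix \<alpha> assume a: "\<alpha> \<in> roots W S"
  show "subgroup (U \<alpha>) G"
    using a by (intro G.subgroupI) (auto simp: U_def root_u_inv root_u_square)
  show "U \<alpha> \<noteq> {\<one>\<^bsub>G\<^esub>}" using root_u_nontrivial[OF a] by (auto simp: U_def)
next
  fix \<alpha> \<beta> assume a: "\<alpha> \<in> roots W S" and b: "\<beta> \<in> roots W S"
    and ab: "prenilpotent W \<alpha> \<beta> \<and> \<alpha> \<noteq> \<beta>"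
  let ?I = "\<Union>\<gamma>\<in>open_root_interval W S \<alpha> \<beta>. U \<gamma>"
  have sub: "?I \<subseteq> carrier G"
    using U_subset by (auto simp: open_root_interval_def closed_root_interval_def)
  have "x \<otimes>\<^bsub>G\<^esub> y \<otimes>\<^bsub>G\<^esub> inv\<^bsub>G\<^esub> x \<otimes>\<^bsub>G\<^esub> inv\<^bsub>G\<^esub> y \<in> generate G ?I" if "x \<in> U \<alpha>" "y \<in> U \<beta>" for x y
  proof (cases "x = \<one>\<^bsub>G\<^esub> \<or> y = \<one>\<^bsub>G\<^esub>")
    case True
    then have "x \<otimes>\<^bsub>G\<^esub> y \<otimes>\<^bsub>G\<^esub> inv\<^bsub>G\<^esub> x \<otimes>\<^bsub>G\<^esub> inv\<^bsub>G\<^esub> y = \<one>\<^bsub>G\<^esub>"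
      using that U_subset[OF a] U_subset[OF b] by auto
    then show ?thesis by (simp add: generate.one)
  next
    case False
    then have "x = root_u \<alpha>" "y = root_u \<beta>" using that by (auto simp: U_def)
    then have "x \<otimes>\<^bsub>G\<^esub> y \<otimes>\<^bsub>G\<^esub> inv\<^bsub>G\<^esub> x \<otimes>\<^bsub>G\<^esub> inv\<^bsub>G\<^esub> y \<in> {\<one>\<^bsub>G\<^esub>} \<union> root_u ` open_root_interval W S \<alpha> \<beta>"
      using prenilpotent_commutator[OF a b] ab a b by (simp add: root_u_inv)
    then show ?thesis
      by (auto simp: U_def intro: generate.one generate.incl)
  qed
  then show "commutator_group G (U \<alpha>) (U \<beta>) \<subseteq> generate G ?I"
    unfolding commutator_group_def
    by (intro G.generate_subgroup_incl[OF _ G.generate_is_subgroup[OF sub]]) blast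
next
  fix s x assume "s \<in> S" "x \<in> U (simple_root W S s) - {\<one>\<^bsub>G\<^esub>}"
  then show "\<exists>n. is_m W S G U s x n"
    using is_m_m[of s] root_u_simple[of s] by (auto simp: U_def)
next
  fix s assume s: "s \<in> S"
  have "root_u (opp W (simple_root W S s)) \<in> U (opp W (simple_root W S s))" by (simp add: U_def)
  moreover have "root_u (opp W (simple_root W S s)) \<notin> rgd_U_plus W S G U"
    using U_plus_fixes moved[OF s] s by (auto simp: root_u_opp_simple)
  ultimately show "\<not> U (opp W (simple_root W S s)) \<subseteq> rgd_U_plus W S G U" by blast
next
  have "carrier G \<subseteq> H <#>\<^bsub>G\<^esub> carrier G"
    using one_in_H by (force simp: set_mult_def)
  moreover have "H <#>\<^bsub>G\<^esub> carrier G \<subseteq> carrier G"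
    using H_iff by (auto simp: set_mult_def)
  ultimately show "carrier G = H <#>\<^bsub>G\<^esub> generate G (\<Union>\<alpha>\<in>roots W S. U \<alpha>)"
    using generated_by_root_groups by simp
qed

lemma over_F2: "over_F2 W S U"
  unfolding over_F2_def U_def using root_u_nontrivial by (simp add: card_2_iff) metis

lemma root_depth_halfspace:
  assumes "p \<in> lists S" "distinct_adj p"
  shows "length p \<le> root_depth W S (halfspace p)"
  unfolding root_depth_def
proof (rule cInf_greatest)
  have "word_val W p \<in> opp W (halfspace p)"
    using assms by (simp add: opp_def) (simp add: halfspace_def nf_reduced)
  then show "cox_length W S ` opp W (halfspace p) \<noteq> {}" by blast
next
  fix n assume "n \<in> cox_length W S ` opp W (halfspace p)"
  then show "length p \<le> n"
    by (auto simp: opp_def halfspace_def cox_length_nf prefix_length_le)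
qed

lemma one_in_B: "\<one>\<^bsub>G\<^esub> \<in> B"
proof -
  have "\<one>\<^bsub>G\<^esub> \<in> rgd_U_plus W S G U" by (simp add: rgd_U_plus_def generate.one)
  then show ?thesis using one_in_H unfolding rgd_B_def set_mult_def by force
qed

lemma B_subset: "B \<subseteq> carrier G"
  using B_fixes by blast

lemma chamber_in_ball:
  assumes w: "w \<in> carrier W" and g: "g \<in> B"
  shows "g \<otimes>\<^bsub>G\<^esub> m w <#\<^bsub>G\<^esub> B \<in> building_ball W S G U (cox_length W S w)"
proof -
  have gc: "g \<in> carrier G" using g B_subset by blast
  have rep: "represents W S G U (m w) w"
    unfolding represents_def using is_weyl_iso m_in_N[OF w] weyl_coset[OF _ w induces_m[OF w]] w
    by (intro conjI exI[of _ "\<lambda>C. the_elem (weyl ` C)"]) simp_all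
  have "g \<otimes>\<^bsub>G\<^esub> m w \<in> (B #>\<^bsub>G\<^esub> m w) <#>\<^bsub>G\<^esub> B"
    using g gc one_in_B w unfolding set_mult_def r_coset_def by force
  moreover have "B = \<one>\<^bsub>G\<^esub> <#\<^bsub>G\<^esub> B" by (simp add: G.lcos_mult_one B_subset)
  ultimately have "delta W S G U B (g \<otimes>\<^bsub>G\<^esub> m w <#\<^bsub>G\<^esub> B) w"
    unfolding delta_def using rep gc w
    by (intro bexI[of _ "\<one>\<^bsub>G\<^esub>"] bexI[of _ "g \<otimes>\<^bsub>G\<^esub> m w"] exI[of _ "m w"]) simp_all
  moreover have "g \<otimes>\<^bsub>G\<^esub> m w <#\<^bsub>G\<^esub> B \<in> chambers W S G U"
    using gc w by (auto simp: chambers_def LCOSETS_def)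
  ultimately show ?thesis unfolding building_ball_def using w by blast
qed

text \<open>Root elements of arbitrarily deep roots have the same commutator \<open>word_u r\<close> with the fixed element
  \<open>word_u p\<close>. Let \<open>w\<close> be the element just beyond the edge \<open>r\<close>. If a deep root element fixes the chamber of \<open>w\<close> and the image
  of that chamber under \<open>word_u p\<close>, which lies in the same ball, then the commutator fixes the chamber of
  \<open>w\<close>; but \<open>word_u r\<close> moves it.\<close>

lemma not_FPRS:
  assumes p: "p \<in> lists S" "p \<noteq> []" "distinct_adj p" and r: "r \<in> lists S" "r \<noteq> []" "distinct_adj r"
    and q: "\<And>n. q n \<in> lists S" "\<And>n. q n \<noteq> []" "\<And>n. distinct_adj (q n)" "\<And>n. n \<le> length (q n)"
    and comm: "\<And>n. word_u p \<otimes>\<^bsub>G\<^esub> word_u (q n) \<otimes>\<^bsub>G\<^esub> word_u p \<otimes>\<^bsub>G\<^esub> word_u (q n) = word_u r"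
  shows "\<not> FPRS W S G U"
proof
  define w where "w = word_val W r"
  assume fprs: "FPRS W S G U"
  have roots: "\<forall>n. halfspace (q n) \<in> roots W S" using q halfspace_root by blast
  have depth: "filterlim (\<lambda>n. root_depth W S (halfspace (q n))) at_top sequentially"
  proof (rule filterlim_at_top_mono[OF filterlim_ident])
    have "n \<le> root_depth W S (halfspace (q n))" for n
      using q(4)[of n] root_depth_halfspace[OF q(1,3), of n] by linarith
    then show "\<forall>\<^sub>F n in sequentially. n \<le> root_depth W S (halfspace (q n))" by simp
  qed
  have "\<exists>n0. \<forall>n\<ge>n0. \<forall>x\<in>U (halfspace (q n)).
      \<forall>c\<in>building_ball W S G U (cox_length W S w). x <#\<^bsub>G\<^esub> c = c"
    using fprs[unfolded FPRS_def, THEN spec, of "\<lambda>n. halfspace (q n)", THEN mp, OF conjI[OF roots depth]]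
    by (rule spec)
  then obtain n where "\<forall>n'\<ge>n. \<forall>x\<in>U (halfspace (q n')).
      \<forall>c\<in>building_ball W S G U (cox_length W S w). x <#\<^bsub>G\<^esub> c = c"
    by (rule exE)
  from this[THEN spec, of n, THEN mp, OF order_refl]
  have n: "\<forall>x\<in>U (halfspace (q n)). \<forall>c\<in>building_ball W S G U (cox_length W S w). x <#\<^bsub>G\<^esub> c = c" .
  have wc: "w \<in> carrier W" using r by (simp add: w_def)
  let ?a = "word_u p" and ?b = "word_u (q n)" and ?c = "m w <#\<^bsub>G\<^esub> B"
  have a: "?a \<in> carrier G" "?a \<otimes>\<^bsub>G\<^esub> ?a = \<one>\<^bsub>G\<^esub>"
    using root_u_closed[OF halfspace_root[OF p]] root_u_square[OF halfspace_root[OF p]] root_u_halfspace[OF p] by auto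
  have b: "?b \<in> carrier G"
    using root_u_closed[OF halfspace_root[OF q(1-3)]] root_u_halfspace[OF q(1-3)] by auto
  have b_fixes: "?b <#\<^bsub>G\<^esub> (g \<otimes>\<^bsub>G\<^esub> m w <#\<^bsub>G\<^esub> B) = g \<otimes>\<^bsub>G\<^esub> m w <#\<^bsub>G\<^esub> B" if "g \<in> B" for g
    using n chamber_in_ball[OF wc that] root_u_halfspace[OF q(1-3)] by (simp add: U_def)
  have "?a \<in> rgd_U_plus W S G U"
  proof -
    have "?a \<in> U (halfspace p)" by (simp add: U_def root_u_halfspace[OF p])
    then show ?thesis
      unfolding rgd_U_plus_def using halfspace_pos_root[OF p] by (intro generate.incl) blast
  qed
  then have "?a \<in> B"
    unfolding rgd_B_def set_mult_def using one_in_H a(1) by force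
  have fix1: "?b <#\<^bsub>G\<^esub> ?c = ?c" using b_fixes[OF one_in_B] wc by simp
  have fix2: "?b <#\<^bsub>G\<^esub> (?a <#\<^bsub>G\<^esub> ?c) = ?a <#\<^bsub>G\<^esub> ?c"
    using b_fixes[OF \<open>?a \<in> B\<close>] a wc by (simp add: G.lcos_m_assoc B_subset)
  have c: "?c \<subseteq> carrier G" using wc by (simp add: G.l_coset_subset_G B_subset)
  have "word_u r <#\<^bsub>G\<^esub> ?c = ?a <#\<^bsub>G\<^esub> (?b <#\<^bsub>G\<^esub> (?a <#\<^bsub>G\<^esub> (?b <#\<^bsub>G\<^esub> ?c)))"
    unfolding comm[of n, symmetric] using a b c by (simp add: G.lcos_m_assoc G.l_coset_subset_G G.m_assoc)
  also have "\<dots> = ?c"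
    unfolding fix1 fix2 using a c by (simp add: G.lcos_m_assoc G.lcos_mult_one)
  finally have fixc: "word_u r <#\<^bsub>G\<^esub> ?c = ?c" .
  \<comment> \<open>Translated back by \<open>w\<close>, the element \<open>word_u r\<close> becomes the root element of \<open>-\<alpha>\<^sub>s\<close>, which is not in \<open>B\<close>.\<close>
  define s where "s = last r"
  define v where "v = word_val W (butlast r)"
  have vs: "v \<in> carrier W" "s \<in> S" using halfspace_decomp[OF r] by (auto simp: v_def s_def)
  have "w = v \<otimes>\<^bsub>W\<^esub> s"
    using word_val_append[of "butlast r" "[s]"] r vs
    by (simp add: w_def v_def s_def S_carrier in_lists_conv_set in_set_butlastD)
  then have mw: "m w = m v \<otimes>\<^bsub>G\<^esub> m s" using vs by (simp add: m_mult S_carrier)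
  have wr: "word_u r = m v \<otimes>\<^bsub>G\<^esub> u s \<otimes>\<^bsub>G\<^esub> inv\<^bsub>G\<^esub> (m v)"
    by (simp add: word_u_def conj_u_def v_def s_def)
  have ms: "m s \<in> carrier G" "u s \<in> carrier G" "m v \<in> carrier G" using vs u_closed S_carrier by auto
  have "m w \<in> ?c" using one_in_B wc by (force simp: l_coset_def)
  then have "word_u r \<otimes>\<^bsub>G\<^esub> m w \<in> word_u r <#\<^bsub>G\<^esub> ?c" unfolding l_coset_def by blast
  then obtain g where g: "g \<in> B" "word_u r \<otimes>\<^bsub>G\<^esub> m w = m w \<otimes>\<^bsub>G\<^esub> g"
    unfolding fixc by (auto simp: l_coset_def)
  have "word_u r \<otimes>\<^bsub>G\<^esub> m w = m v \<otimes>\<^bsub>G\<^esub> (u s \<otimes>\<^bsub>G\<^esub> m s)"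
    unfolding wr mw using ms by (simp add: G.m_assoc) (simp add: G.m_assoc[symmetric])
  moreover have "m w \<otimes>\<^bsub>G\<^esub> g = m v \<otimes>\<^bsub>G\<^esub> (m s \<otimes>\<^bsub>G\<^esub> g)"
    unfolding mw using ms g B_subset by (simp add: G.m_assoc subset_iff)
  ultimately have "u s \<otimes>\<^bsub>G\<^esub> m s = m s \<otimes>\<^bsub>G\<^esub> g"
    using g ms B_subset by (simp add: subset_iff)
  then have "m s \<otimes>\<^bsub>G\<^esub> u s \<otimes>\<^bsub>G\<^esub> m s = g"
    using ms g B_subset m_S_square[OF vs(2)] by (simp add: G.m_assoc subset_iff) (simp add: G.m_assoc[symmetric] subset_iff)
  then show False using g B_fixes moved[OF vs(2)] by blast
qed

end


section \<open>The action on galleries\<close>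

text \<open>For words \<open>p\<close> and \<open>p q\<close> with \<open>s = last p\<close>, the commutator of the root elements is intended to be the
  root element of \<open>p t\<close> if \<open>linked t s q\<close>, and trivial otherwise.\<close>

definition linked :: "'a \<Rightarrow> 'a \<Rightarrow> 'a list \<Rightarrow> bool" where
  "linked t s q \<longleftrightarrow> s \<noteq> t \<and> hd q = t \<and> last q \<noteq> t"

text \<open>A gallery \<open>(s, x) c\<close> stands for the chamber \<open>u\<^sub>s\<^sup>x m\<^sub>s c\<close>. The clauses are what the relations
  demand. On \<open>m\<^sub>s c\<close>, the element \<open>u\<^sub>p\<close> acts on the tail as \<open>m\<^sub>s u\<^sub>p m\<^sub>s\<close>, which is the root element of \<open>sp\<close>. On
  \<open>u\<^sub>s m\<^sub>s c\<close> there are two cases. If \<open>p = s q\<close>, then \<open>u\<^sub>p\<close> is first moved past \<open>u\<^sub>s\<close>, at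
  the cost of the commutator, whose root element \<open>u\<^sub>s\<^sub>t\<close> acts on the tail as \<open>u\<^sub>t\<close>. If \<open>p\<close> does not begin with \<open>s\<close>,
  there is no relation between \<open>u\<^sub>p\<close> and \<open>u\<^sub>s\<close>, but \<open>u\<^sub>s m\<^sub>s = m\<^sub>s u\<^sub>s m\<^sub>s u\<^sub>s\<close> reduces the task to moving the root
  element of \<open>sp\<close> past \<open>u\<^sub>s\<close>, up to conjugation by \<open>u\<^sub>s\<close> on the tail.\<close>

function root_act :: "'a \<Rightarrow> 'a list \<Rightarrow> ('a \<times> bool) list \<Rightarrow> ('a \<times> bool) list" where
  "root_act t p [] = []"
| "root_act t p ((s, x) # c) =
     (if hd p \<noteq> s then
        if x then (s, True) # root_act t [s] (root_act t p
          (let d = root_act t [s] c in if linked t s p then root_act t [t] d else d))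
        else (s, False) # root_act t (s # p) c
      else if tl p = [] then (s, \<not> x) # c
      else (s, x) # root_act t (tl p) (if x \<and> linked t s (tl p) then root_act t [t] c else c))"
  by pat_completeness auto

text \<open>Termination of the nested recursion needs that lengths are preserved.\<close>

lemma length_root_act_dom: "root_act_dom (t, p, c) \<Longrightarrow> length (root_act t p c) = length c"
  by (induction t p c rule: root_act.pinduct) (auto simp: root_act.psimps Let_def)

termination
  by (relation "measure (\<lambda>(t, p, c). length c)") (auto simp: length_root_act_dom Let_def)

lemma length_root_act [simp]: "length (root_act t p c) = length c"
  by (induction t p c rule: root_act.induct) (auto simp: Let_def)

text \<open>The effect on the tail of moving a root element past \<open>u\<^sub>s\<close>.\<close>

definition twisted_root_act :: "'a \<Rightarrow> 'a \<Rightarrow> 'a list \<Rightarrow> ('a \<times> bool) list \<Rightarrow> ('a \<times> bool) list" where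
  "twisted_root_act t s p c = root_act t p (if linked t s p then root_act t [t] c else c)"

lemma length_twisted_root_act [simp]: "length (twisted_root_act t s p c) = length c"
  by (simp add: twisted_root_act_def)

lemma root_act_cases:
  "root_act t [s] ((s, x) # c) = (s, \<not> x) # c"
  "p \<noteq> [] \<Longrightarrow> root_act t (s # p) ((s, False) # c) = (s, False) # root_act t p c"
  "p \<noteq> [] \<Longrightarrow> root_act t (s # p) ((s, True) # c) = (s, True) # twisted_root_act t s p c"
  "hd p \<noteq> s \<Longrightarrow> root_act t p ((s, False) # c) = (s, False) # root_act t (s # p) c"
  "hd p \<noteq> s \<Longrightarrow> root_act t p ((s, True) # c) =
     (s, True) # root_act t [s] (twisted_root_act t s p (root_act t [s] c))"
  by (simp_all add: twisted_root_act_def Let_def)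

declare root_act.simps(2) [simp del]

lemma map_fst_root_act [simp]: "map fst (root_act t p c) = map fst c"
  by (induction t p c rule: root_act.induct) (auto simp: root_act.simps Let_def)

definition relations_at :: "'a \<Rightarrow> nat \<Rightarrow> bool" where
  "relations_at t n \<longleftrightarrow>
     (\<forall>c p. length c = n \<longrightarrow> p \<noteq> [] \<longrightarrow> root_act t p (root_act t p c) = c) \<and>
     (\<forall>c p q. length c = n \<longrightarrow> p \<noteq> [] \<longrightarrow> q \<noteq> [] \<longrightarrow>
        root_act t p (root_act t (p @ q) c) =
          root_act t (p @ q) (root_act t p (if linked t (last p) q then root_act t (p @ [t]) c else c)))"

lemma relations_atD:
  assumes "relations_at t (length c)" "p \<noteq> []"
  shows "root_act t p (root_act t p c) = c"
    "q \<noteq> [] \<Longrightarrow> root_act t p (root_act t (p @ q) c) =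
          root_act t (p @ q) (root_act t p (if linked t (last p) q then root_act t (p @ [t]) c else c))"
  using assms by (auto simp: relations_at_def)

text \<open>Nothing is linked to an edge of type \<open>t\<close>, so its root element commutes with those of all edges further along
  the path.\<close>

lemma root_act_t_commute:
  assumes "relations_at t (length c)" "p \<noteq> []" "hd p = t"
  shows "root_act t [t] (root_act t p c) = root_act t p (root_act t [t] c)"
  using relations_atD(2)[OF assms(1), of "[t]" "tl p"] assms(2,3)
  by (cases p; cases "tl p") (auto simp: linked_def)

lemma twisted_root_act_involution:
  assumes "relations_at t (length c)" "p \<noteq> []"
  shows "twisted_root_act t s p (twisted_root_act t s p c) = c"
  using assms relations_atD(1)[of t c p] relations_atD(1)[of t c "[t]"]
   root_act_t_commute[of t c p] root_act_t_commute[of t "root_act t [t] c" p]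
  by (auto simp: twisted_root_act_def linked_def)

text \<open>On the tail, conjugation by \<open>u\<^sub>s\<close> multiplies some of the generators along a path by the central
  element \<open>u\<^sub>t\<close>, which leaves their commutators unchanged. So the twisted elements satisfy the same relations.\<close>

lemma twisted_root_act_relation:
  assumes "relations_at t (length c)" "p \<noteq> []" "q \<noteq> []"
  shows "twisted_root_act t s p (twisted_root_act t s (p @ q) c) =
     twisted_root_act t s (p @ q) (twisted_root_act t s p (if linked t (last p) q then twisted_root_act t s (p @ [t]) c else c))"
proof (cases "s \<noteq> t \<and> hd p = t")
  case True
  have at: "relations_at t (length d)" if "length d = length c" for d :: "('a \<times> bool) list"
    using that assms by simp
  have R: "root_act t p (root_act t (p @ q) d) =
          root_act t (p @ q) (root_act t p (if linked t (last p) q then root_act t (p @ [t]) d else d))"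
    "root_act t [t] (root_act t [t] d) = d"
    "root_act t [t] (root_act t p d) = root_act t p (root_act t [t] d)"
    "root_act t [t] (root_act t (p @ q) d) = root_act t (p @ q) (root_act t [t] d)"
    "root_act t [t] (root_act t (p @ [t]) d) = root_act t (p @ [t]) (root_act t [t] d)"
    if "length d = length c" for d
    subgoal using relations_atD(2)[OF at[OF that] assms(2,3)] .
    subgoal using relations_atD(1)[OF at[OF that], of "[t]"] by blast
    subgoal using root_act_t_commute[OF at[OF that] assms(2)] True by blast
    subgoal using root_act_t_commute[OF at[OF that], of "p @ q"] assms(2) True by simp
    subgoal using root_act_t_commute[OF at[OF that], of "p @ [t]"] assms(2) True by simp
    done
  show ?thesis
    using True assms(2,3) by (auto simp: twisted_root_act_def linked_def R)
next
  case False
  then have "\<not> linked t s p" "\<not> linked t s (p @ q)" "\<not> linked t s (p @ [t])"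
    using assms by (auto simp: linked_def)
  then show ?thesis
    using relations_atD(2)[OF assms] by (simp add: twisted_root_act_def)
qed

text \<open>On a gallery with first letter \<open>s\<close>, either \<open>p\<close> and \<open>p q\<close> act on the tail through words that are again of the
  form \<open>p'\<close> and \<open>p' q\<close>, up to twisting and conjugation, and the relations of the tail apply; or \<open>p = s\<close>. In the
  latter case \<open>u\<^sub>s\<close> flips the bit, and the commutator compares the two ways in which \<open>u\<^sub>s\<^sub>q\<close> acts on the tail,
  depending on the bit; they differ by \<open>u\<^sub>t\<close> exactly if the edges are linked.\<close>

lemma relations_at: "relations_at t n"
proof (induction n)
  case 0
  then show ?case by (simp add: relations_at_def)
next
  case (Suc n)
  have R: "relations_at t (length c)" if "length c = n" for c :: "('a \<times> bool) list"
    using Suc that by simp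
  have I: "root_act t p (root_act t p c) = c" "twisted_root_act t s p (twisted_root_act t s p c) = c"
    if "length c = n" "p \<noteq> []" for c p s
    using relations_atD(1)[OF R[OF that(1)] that(2)]
      twisted_root_act_involution[OF R[OF that(1)] that(2)] .
  have C: "root_act t p (root_act t (p @ q) c) =
          root_act t (p @ q) (root_act t p (if linked t (last p) q then root_act t (p @ [t]) c else c))"
    "twisted_root_act t s p (twisted_root_act t s (p @ q) c) =
     twisted_root_act t s (p @ q) (twisted_root_act t s p (if linked t (last p) q then twisted_root_act t s (p @ [t]) c else c))"
    if "length c = n" "p \<noteq> []" "q \<noteq> []" for c p q s
    using relations_atD(2)[OF R[OF that(1)] that(2,3)]
      twisted_root_act_relation[OF R[OF that(1)] that(2,3)] .
  have "root_act t p (root_act t p (y # c)) = y # c"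
    if len: "length c = n" and p: "p \<noteq> []" for c p y
  proof -
    obtain s x where y: "y = (s, x)" by force
    obtain a p' where p': "p = a # p'" using p by (cases p) auto
    show ?thesis
      using len p p'
      by (cases x; cases "a = s"; cases "p' = []") (auto simp: y root_act_cases I)
  qed
  moreover have "root_act t p (root_act t (p @ q) (y # c)) =
      root_act t (p @ q) (root_act t p (if linked t (last p) q then root_act t (p @ [t]) (y # c) else y # c))"
    if len: "length c = n" and p: "p \<noteq> []" and q: "q \<noteq> []" for c p q y
  proof -
    obtain s x where y: "y = (s, x)" by force
    obtain a p' where p': "p = a # p'" using p by (cases p) auto
    consider "a \<noteq> s" | "a = s" "p' \<noteq> []" | "a = s" "p' = []" by blast
    then show ?thesis
    proof cases
      case 1
      then show ?thesis
        using len q C(1)[of c "s # p" q] C(2)[of _ p q s]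
        by (cases x) (auto simp: y p' root_act_cases I)
    next
      case 2
      then show ?thesis
        using len q by (cases x) (auto simp: y p' root_act_cases C)
    next
      case 3
      have "root_act t [t] (root_act t q c) = root_act t q (root_act t [t] c)" if "hd q = t"
        by (rule root_act_t_commute[OF R[OF len] q that])
      moreover have "\<not> linked t s [t]" by (simp add: linked_def)
      ultimately show ?thesis
        using len q 3 by (cases x) (auto simp: y p' root_act_cases I twisted_root_act_def linked_def)
    qed
  qed
  ultimately show ?case
    unfolding relations_at_def length_Suc_conv by blast
qed

text \<open>The action of \<open>m\<^sub>s\<close>. It swaps \<open>c\<close> with \<open>m\<^sub>s c\<close>. The third chamber \<open>u\<^sub>s m\<^sub>s c\<close> of the panel is mapped to
  \<open>u\<^sub>s m\<^sub>s u\<^sub>s c\<close> by the braid relation.\<close>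

fun reflect :: "'a \<Rightarrow> 'a \<Rightarrow> ('a \<times> bool) list \<Rightarrow> ('a \<times> bool) list" where
  "reflect t s [] = [(s, False)]"
| "reflect t s ((a, x) # c) =
     (if a \<noteq> s then (s, False) # (a, x) # c else if x then (s, True) # root_act t [s] c else c)"

definition gallery :: "'a set \<Rightarrow> ('a \<times> bool) list \<Rightarrow> bool" where
  "gallery S c \<longleftrightarrow> set (map fst c) \<subseteq> S \<and> distinct_adj (map fst c)"

lemma root_act_involution: "p \<noteq> [] \<Longrightarrow> root_act t p (root_act t p c) = c"
  by (rule relations_atD(1)[OF relations_at])

lemma root_act_relation:
  assumes "p \<noteq> []" "q \<noteq> []"
  shows "root_act t p (root_act t (p @ q) (root_act t p (root_act t (p @ q) c))) =
     (if linked t (last p) q then root_act t (p @ [t]) c else c)"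
  using assms relations_atD(2)[OF relations_at assms, of t c] by (simp add: root_act_involution)

lemma gallery_root_act [simp]: "gallery S (root_act t p c) \<longleftrightarrow> gallery S c"
  by (simp add: gallery_def del: set_map)

lemma gallery_reflect:
  assumes "s \<in> S" "gallery S c"
  shows "gallery S (reflect t s c)"
proof (cases c)
  case Nil
  then show ?thesis using assms by (simp add: gallery_def)
next
  case (Cons y d)
  then show ?thesis
    using assms by (cases y) (auto simp: gallery_def distinct_adj_Cons simp del: set_map)
qed

lemma gallery_hd_neq:
  assumes "gallery S ((s, x) # c)"
  shows "c = [] \<or> fst (hd c) \<noteq> s"
  using assms by (cases c) (auto simp: gallery_def)

lemma reflect_other: "c = [] \<or> fst (hd c) \<noteq> s \<Longrightarrow> reflect t s c = (s, False) # c"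
  by (cases c) auto

lemma hd_root_act: "c \<noteq> [] \<Longrightarrow> fst (hd (root_act t p c)) = fst (hd c)"
  using map_fst_root_act[of t p c] by (metis hd_map map_is_Nil_conv)

lemma root_act_eq_Nil [simp]: "root_act t p c = [] \<longleftrightarrow> c = []"
  using length_root_act[of t p c] by (metis length_0_conv)

lemma reflect_other_root_act:
  "c = [] \<or> fst (hd c) \<noteq> s \<Longrightarrow> reflect t s (root_act t p c) = (s, False) # root_act t p c"
  by (rule reflect_other) (auto simp: hd_root_act)

lemma gallery_cases:
  assumes "gallery S c"
  obtains (other) "c = [] \<or> fst (hd c) \<noteq> s"
  | (zero) d where "c = (s, False) # d" "d = [] \<or> fst (hd d) \<noteq> s"
  | (one) d where "c = (s, True) # d" "d = [] \<or> fst (hd d) \<noteq> s"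
proof (cases c)
  case Nil
  then show ?thesis using other by blast
next
  case (Cons y d)
  obtain a x where y: "y = (a, x)" by force
  show ?thesis
  proof (cases "a = s")
    case True
    then have "d = [] \<or> fst (hd d) \<noteq> s" using gallery_hd_neq assms Cons y by fast
    then show ?thesis using zero one Cons y True by (cases x) auto
  next
    case False
    then show ?thesis using other Cons y by simp
  qed
qed

lemma reflect_involution: "gallery S c \<Longrightarrow> reflect t s (reflect t s c) = c"
  by (erule gallery_cases[where s = s]) (auto simp: reflect_other root_act_involution)

lemma reflect_root_act:
  assumes "gallery S c" "p \<noteq> []" "hd p \<noteq> s"
  shows "reflect t s (root_act t p (reflect t s c)) = root_act t (s # p) c"
  using assms(1)
proof (cases rule: gallery_cases[where s = s])
  case other
  then show ?thesis using assms(2,3) by (simp add: reflect_other root_act_cases)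
next
  case zero
  then show ?thesis using assms(2,3) by (simp add: reflect_other_root_act root_act_cases)
next
  case one
  then show ?thesis using assms(2,3) by (simp add: root_act_cases root_act_involution)
qed

lemma braid_relation:
  assumes "gallery S c"
  shows "root_act t [s] (reflect t s (root_act t [s] c)) = reflect t s (root_act t [s] (reflect t s c))"
  using assms
proof (cases rule: gallery_cases[where s = s])
  case other
  then show ?thesis by (simp add: reflect_other reflect_other_root_act root_act_cases)
next
  case zero
  then show ?thesis by (simp add: reflect_other_root_act root_act_cases root_act_involution)
next
  case one
  then show ?thesis by (simp add: reflect_other_root_act root_act_cases root_act_involution)
qed

text \<open>Extended by the identity to lists that are not galleries, the maps become permutations of a
  type, whose composition is that of functions.\<close>

definition root_perm :: "'a set \<Rightarrow> 'a \<Rightarrow> 'a list \<Rightarrow> ('a \<times> bool) list \<Rightarrow> ('a \<times> bool) list" where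
  "root_perm S t p c = (if gallery S c then root_act t p c else c)"

definition reflect_perm :: "'a set \<Rightarrow> 'a \<Rightarrow> 'a \<Rightarrow> ('a \<times> bool) list \<Rightarrow> ('a \<times> bool) list" where
  "reflect_perm S t s c = (if gallery S c then reflect t s c else c)"

lemma root_perm_involution: "p \<noteq> [] \<Longrightarrow> root_perm S t p \<circ> root_perm S t p = id"
  by (auto simp: root_perm_def fun_eq_iff root_act_involution)

lemma reflect_perm_involution: "s \<in> S \<Longrightarrow> reflect_perm S t s \<circ> reflect_perm S t s = id"
  by (auto simp: reflect_perm_def fun_eq_iff reflect_involution gallery_reflect)

lemma reflect_perm_root_perm:
  "s \<in> S \<Longrightarrow> p \<noteq> [] \<Longrightarrow> hd p \<noteq> s \<Longrightarrow>
    reflect_perm S t s \<circ> root_perm S t p \<circ> reflect_perm S t s = root_perm S t (s # p)"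
  by (auto simp: reflect_perm_def root_perm_def fun_eq_iff reflect_root_act gallery_reflect)

lemma perm_braid:
  "s \<in> S \<Longrightarrow> root_perm S t [s] \<circ> reflect_perm S t s \<circ> root_perm S t [s] =
     reflect_perm S t s \<circ> root_perm S t [s] \<circ> reflect_perm S t s"
  by (auto simp: reflect_perm_def root_perm_def fun_eq_iff braid_relation gallery_reflect)

lemma root_perm_relation:
  "p \<noteq> [] \<Longrightarrow> q \<noteq> [] \<Longrightarrow>
    root_perm S t p \<circ> root_perm S t (p @ q) \<circ> root_perm S t p \<circ> root_perm S t (p @ q) =
      (if linked t (last p) q then root_perm S t (p @ [t]) else id)"
  by (auto simp: root_perm_def fun_eq_iff root_act_relation)

text \<open>The generators are involutions, so their products already form a group.\<close>

inductive_set perms :: "'a set \<Rightarrow> 'a \<Rightarrow> (('a \<times> bool) list \<Rightarrow> ('a \<times> bool) list) set"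
  for S t where
  perms_id: "id \<in> perms S t"
| perms_root: "f \<in> perms S t \<Longrightarrow> s \<in> S \<Longrightarrow> root_perm S t [s] \<circ> f \<in> perms S t"
| perms_reflect: "f \<in> perms S t \<Longrightarrow> s \<in> S \<Longrightarrow> reflect_perm S t s \<circ> f \<in> perms S t"

lemma perms_comp: "f \<in> perms S t \<Longrightarrow> g \<in> perms S t \<Longrightarrow> f \<circ> g \<in> perms S t"
  by (induction rule: perms.induct) (auto simp: comp_assoc intro: perms.intros)

lemma perms_generators:
  "s \<in> S \<Longrightarrow> root_perm S t [s] \<in> perms S t" "s \<in> S \<Longrightarrow> reflect_perm S t s \<in> perms S t"
  using perms_root[OF perms_id] perms_reflect[OF perms_id] by fastforce+

lemma perms_inverse: "f \<in> perms S t \<Longrightarrow> \<exists>g\<in>perms S t. g \<circ> f = id"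
proof (induction rule: perms.induct)
  case perms_id
  show ?case by (rule bexI[OF _ perms.perms_id]) simp
next
  case (perms_root f s)
  then obtain g where g: "g \<in> perms S t" "g \<circ> f = id" by blast
  have "(g \<circ> root_perm S t [s]) \<circ> (root_perm S t [s] \<circ> f) = id"
    using g(2) by (metis comp_assoc comp_id list.distinct(1) root_perm_involution)
  then show ?case
    using perms_comp[OF g(1) perms_generators(1)[OF perms_root(2)]] by (rule bexI)
next
  case (perms_reflect f s)
  then obtain g where g: "g \<in> perms S t" "g \<circ> f = id" by blast
  have "(g \<circ> reflect_perm S t s) \<circ> (reflect_perm S t s \<circ> f) = id"
    using g(2) by (metis comp_assoc comp_id reflect_perm_involution perms_reflect(2))
  then show ?case
    using perms_comp[OF g(1) perms_generators(2)[OF perms_reflect(2)]] by (rule bexI)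
qed

lemma perms_gallery: "f \<in> perms S t \<Longrightarrow> gallery S c \<Longrightarrow> gallery S (f c)"
  by (induction rule: perms.induct) (auto simp: root_perm_def reflect_perm_def gallery_reflect)

primrec word_perm :: "'a set \<Rightarrow> 'a \<Rightarrow> 'a list \<Rightarrow> ('a \<times> bool) list \<Rightarrow> ('a \<times> bool) list" where
  "word_perm S t [] = id"
| "word_perm S t (s # ws) = reflect_perm S t s \<circ> word_perm S t ws"

lemma word_perm_perms: "ws \<in> lists S \<Longrightarrow> word_perm S t ws \<in> perms S t"
  by (induction ws) (auto simp: perms_id perms_reflect)

lemma countable_perms:
  assumes "finite S"
  shows "countable (perms S t)"
proof -
  define gen where "gen = (\<lambda>(s, x). if x then root_perm S t [s] else reflect_perm S t s)"
  define val where "val = rec_list id (\<lambda>w _ f. gen w \<circ> f)"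
  have val: "val [] = id" "val (w # ws) = gen w \<circ> val ws" for w ws
    by (simp_all add: val_def)
  have "f \<in> val ` lists (S \<times> UNIV)" if "f \<in> perms S t" for f
    using that
  proof (induction rule: perms.induct)
    case perms_id
    show ?case by (rule image_eqI[of _ _ "[]"]) (simp_all add: val)
  next
    case (perms_root f s)
    then obtain ws where ws: "ws \<in> lists (S \<times> UNIV)" "f = val ws" by blast
    have "root_perm S t [s] \<circ> f = val ((s, True) # ws)" by (simp add: val ws(2) gen_def)
    then show ?case by (rule image_eqI) (use perms_root(2) ws(1) in simp)
  next
    case (perms_reflect f s)
    then obtain ws where ws: "ws \<in> lists (S \<times> UNIV)" "f = val ws" by blast
    have "reflect_perm S t s \<circ> f = val ((s, False) # ws)" by (simp add: val ws(2) gen_def)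
    then show ?case by (rule image_eqI) (use perms_reflect(2) ws(1) in simp)
  qed
  moreover have "countable (lists (S \<times> (UNIV :: bool set)))"
    using assms by (intro countable_lists countable_finite) simp
  ultimately show ?thesis by (meson countable_image countable_subset subsetI)
qed


section \<open>A countable copy of the permutation group\<close>

lemma nat_group_of_permutations:
  fixes C :: "('x \<Rightarrow> 'x) set"
  assumes "countable C" "id \<in> C" "\<And>f g. f \<in> C \<Longrightarrow> g \<in> C \<Longrightarrow> f \<circ> g \<in> C"
    "\<And>f. f \<in> C \<Longrightarrow> \<exists>g\<in>C. g \<circ> f = id"
  obtains G :: "nat monoid" and e where "group G" "inj_on e C" "carrier G = e ` C" "\<one>\<^bsub>G\<^esub> = e id"
    "\<And>f g. f \<in> C \<Longrightarrow> g \<in> C \<Longrightarrow> e f \<otimes>\<^bsub>G\<^esub> e g = e (f \<circ> g)"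
proof -
  define e where "e = to_nat_on C"
  have inj: "inj_on e C" using assms(1) by (simp add: e_def inj_on_to_nat_on)
  define d where "d = the_inv_into C e"
  have d: "d (e f) = f" if "f \<in> C" for f using inj that by (simp add: d_def the_inv_into_f_f)
  define G :: "nat monoid" where
    "G = \<lparr>carrier = e ` C, monoid.mult = (\<lambda>x y. e (d x \<circ> d y)), one = e id\<rparr>"
  have mult: "e f \<otimes>\<^bsub>G\<^esub> e g = e (f \<circ> g)" if "f \<in> C" "g \<in> C" for f g
    using that by (simp add: G_def d)
  have "group G"
  proof (rule groupI)
    fix x assume "x \<in> carrier G"
    then obtain f where f: "f \<in> C" "x = e f" by (auto simp: G_def)
    then obtain g where "g \<in> C" "g \<circ> f = id" using assms(4) by blast
    then show "\<exists>y\<in>carrier G. y \<otimes>\<^bsub>G\<^esub> x = \<one>\<^bsub>G\<^esub>"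
      using f mult[of g f] by (intro bexI[of _ "e g"]) (auto simp: G_def)
  qed (use assms(2,3) in \<open>auto simp: G_def d comp_assoc\<close>)
  then show ?thesis
    using that inj mult by (simp add: G_def)
qed


text \<open>The group \<open>perms S t\<close> is copied along an injection \<open>e\<close>, which allows a countable group to be
  placed on the natural numbers.\<close>

locale perms_copy = universal_coxeter W S + G: group G
  for W :: "('a, 'b) monoid_scheme" and S and G :: "('g, 'h) monoid_scheme" +
  fixes t :: 'a and e :: "(('a \<times> bool) list \<Rightarrow> ('a \<times> bool) list) \<Rightarrow> 'g"
  assumes t: "t \<in> S"
    and inj: "inj_on e (perms S t)"
    and carrier: "carrier G = e ` perms S t"
    and one: "\<one>\<^bsub>G\<^esub> = e id"
    and mult: "f \<in> perms S t \<Longrightarrow> g \<in> perms S t \<Longrightarrow> e f \<otimes>\<^bsub>G\<^esub> e g = e (f \<circ> g)"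
begin

definition copy_m :: "'a \<Rightarrow> 'g" where
  "copy_m w = e (word_perm S t (nf w))"

definition copy_u :: "'a \<Rightarrow> 'g" where
  "copy_u s = e (root_perm S t [s])"

definition copy_act :: "'g \<Rightarrow> ('a \<times> bool) list \<Rightarrow> ('a \<times> bool) list" where
  "copy_act = the_inv_into (perms S t) e"

lemma copy_act [simp]: "f \<in> perms S t \<Longrightarrow> copy_act (e f) = f"
  using inj by (simp add: copy_act_def the_inv_into_f_f)

lemma word_perm_nf: "w \<in> carrier W \<Longrightarrow> word_perm S t (nf w) \<in> perms S t"
  by (rule word_perm_perms[OF nf_in_lists])

lemma word_perm_nf_Cons:
  assumes "s \<in> S" "w \<in> carrier W"
  shows "word_perm S t (nf (s \<otimes>\<^bsub>W\<^esub> w)) = reflect_perm S t s \<circ> word_perm S t (nf w)"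
  using assms by (cases "nf w") (auto simp: nf_mult reflect_perm_involution simp flip: comp_assoc)

lemma word_perm_nf_mult:
  assumes "v \<in> carrier W" "w \<in> carrier W"
  shows "word_perm S t (nf (v \<otimes>\<^bsub>W\<^esub> w)) = word_perm S t (nf v) \<circ> word_perm S t (nf w)"
proof -
  have "word_perm S t (nf (word_val W ws \<otimes>\<^bsub>W\<^esub> w)) = word_perm S t (nf (word_val W ws)) \<circ> word_perm S t (nf w)"
    if "ws \<in> lists S" for ws
    using that
  proof (induction ws)
    case Nil
    then show ?case using assms(2) by simp
  next
    case (Cons s ws)
    then show ?case
      using assms(2) by (simp add: W.m_assoc S_carrier word_perm_nf_Cons comp_assoc)
  qed
  then show ?thesis using nf_in_lists[OF assms(1)] word_val_nf[OF assms(1)] by metis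
qed

lemma copy_m_S: "s \<in> S \<Longrightarrow> copy_m s = e (reflect_perm S t s)"
  using word_perm_nf_Cons[of s "\<one>\<^bsub>W\<^esub>"] by (simp add: S_carrier copy_m_def)

lemma copy_closed: "s \<in> S \<Longrightarrow> copy_u s \<in> carrier G" "s \<in> S \<Longrightarrow> copy_m s \<in> carrier G"
  using perms_generators[of s S t] by (simp_all add: copy_u_def copy_m_S carrier)

sublocale rgd_action W S G copy_m copy_u copy_act "[]"
proof
  show "copy_m \<in> hom W G"
    by (rule homI) (simp_all add: copy_m_def carrier mult word_perm_nf word_perm_nf_mult)
next
  fix s assume s: "s \<in> S"
  note gens = perms_generators[OF s]
  show "copy_u s \<in> carrier G" using copy_closed s by simp
  show "copy_u s \<otimes>\<^bsub>G\<^esub> copy_u s = \<one>\<^bsub>G\<^esub>"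
    by (simp add: copy_u_def one mult gens root_perm_involution)
  show "copy_u s \<otimes>\<^bsub>G\<^esub> copy_m s \<otimes>\<^bsub>G\<^esub> copy_u s = copy_m s \<otimes>\<^bsub>G\<^esub> copy_u s \<otimes>\<^bsub>G\<^esub> copy_m s"
    using perm_braid[OF s] by (simp add: copy_u_def copy_m_S s mult gens perms_comp)
  show "copy_act (copy_m s \<otimes>\<^bsub>G\<^esub> copy_u s \<otimes>\<^bsub>G\<^esub> copy_m s) [] \<noteq> []"
    using s by (simp add: copy_u_def copy_m_S mult gens perms_comp)
      (simp add: root_perm_def reflect_perm_def gallery_def root_act_cases)
next
  let ?K = "generate G (copy_u ` S \<union> copy_m ` S)"
  have "e f \<in> ?K" if "f \<in> perms S t" for f
    using that
  proof (induction rule: perms.induct)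
    case perms_id
    show ?case using generate.one[of G "copy_u ` S \<union> copy_m ` S"] unfolding one .
  next
    case (perms_root f s)
    have "e (root_perm S t [s] \<circ> f) = copy_u s \<otimes>\<^bsub>G\<^esub> e f"
      using perms_root perms_generators[of s S t] by (simp add: copy_u_def mult)
    then show ?case using perms_root by (simp add: comp_def generate.eng generate.incl)
  next
    case (perms_reflect f s)
    have "e (reflect_perm S t s \<circ> f) = copy_m s \<otimes>\<^bsub>G\<^esub> e f"
      using perms_reflect perms_generators[of s S t] by (simp add: copy_m_S mult)
    then show ?case using perms_reflect by (simp add: comp_def generate.eng generate.incl)
  qed
  moreover have "?K \<subseteq> carrier G"
    using copy_closed by (intro G.generate_incl) blast
  ultimately show "carrier G = ?K" by (auto simp: carrier)
next
  fix c show "copy_act \<one>\<^bsub>G\<^esub> c = c" by (simp add: one perms_id)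
next
  fix g h c assume "g \<in> carrier G" "h \<in> carrier G"
  then show "copy_act (g \<otimes>\<^bsub>G\<^esub> h) c = copy_act g (copy_act h c)"
    by (auto simp: carrier mult perms_comp)
next
  fix g assume g: "g \<in> carrier G"
    and fixed: "\<And>s. s \<in> S \<Longrightarrow> copy_act (copy_u s) (copy_act g []) = copy_act g []"
  then obtain f where f: "f \<in> perms S t" "copy_act g = f" by (auto simp: carrier)
  have gal: "gallery S (f [])" using f(1) by (rule perms_gallery) (simp add: gallery_def)
  show "copy_act g [] = []"
  proof (cases "f []")
    case (Cons y c)
    obtain s x where y: "y = (s, x)" by force
    then have s: "s \<in> S" using gal Cons by (simp add: gallery_def)
    \<comment> \<open>A gallery that begins with \<open>s\<close> is moved by \<open>u\<^sub>s\<close>, which flips its first bit.\<close>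
    show ?thesis
      using fixed[OF s] gal perms_generators(1)[OF s]
      by (simp add: copy_u_def f root_perm_def Cons y root_act_cases)
  qed (simp add: f)
qed

lemma word_u_eq:
  assumes "p \<in> lists S" "p \<noteq> []" "distinct_adj p"
  shows "word_u p = e (root_perm S t p) \<and> root_perm S t p \<in> perms S t"
  using assms
proof (induction p rule: list.induct)
  case (Cons s p)
  then have s: "s \<in> S" by simp
  show ?case
  proof (cases "p = []")
    case True
    then show ?thesis
      using s copy_closed(1)[OF s] perms_generators(1)[OF s]
      by (simp add: word_u_def conj_u_def m_one) (simp add: copy_u_def)
  next
    case False
    then have p: "word_u p = e (root_perm S t p)" "root_perm S t p \<in> perms S t" "hd p \<noteq> s"
      using Cons by (auto simp: distinct_adj_Cons)
    have d: "word_val W (butlast p) \<in> carrier W" "last p \<in> S"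
      using halfspace_decomp[of p] False Cons.prems by (simp_all add: distinct_adj_Cons)
    have "word_u (s # p) = copy_m s \<otimes>\<^bsub>G\<^esub> word_u p \<otimes>\<^bsub>G\<^esub> copy_m s"
      using False s d G.conj_conj[of "copy_m s" "copy_m (word_val W (butlast p))" "copy_u (last p)"]
        copy_closed(1)[OF d(2)] copy_closed(2)[OF s]
      by (simp add: word_u_def conj_u_def m_mult S_carrier m_S_inv)
    also have "\<dots> = e (reflect_perm S t s \<circ> root_perm S t p \<circ> reflect_perm S t s)"
      using p s perms_generators[OF s] by (simp add: copy_m_S mult perms_comp)
    finally show ?thesis
      using p s False perms_generators[OF s] perms_comp reflect_perm_root_perm[OF s False p(3)]
      by metis
  qed
qed simp

lemma word_u_commutator:
  assumes pq: "p @ q \<in> lists S" "p \<noteq> []" "q \<noteq> []" "distinct_adj (p @ q)"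
  shows "word_u p \<otimes>\<^bsub>G\<^esub> word_u (p @ q) \<otimes>\<^bsub>G\<^esub> word_u p \<otimes>\<^bsub>G\<^esub> word_u (p @ q)
      = (if linked t (last p) q then word_u (p @ [t]) else \<one>\<^bsub>G\<^esub>)"
proof -
  have p: "p \<in> lists S" "distinct_adj p" using pq by (auto simp: distinct_adj_append_iff)
  have "word_u (p @ [t]) = e (root_perm S t (p @ [t]))" if "linked t (last p) q"
    using word_u_eq[of "p @ [t]"] that p pq(2) t by (simp add: distinct_adj_append_iff linked_def)
  then show ?thesis
    using word_u_eq[OF p(1) pq(2) p(2)] word_u_eq[OF pq(1) _ pq(4)] root_perm_relation[OF pq(2,3), of S t] pq
    by (simp add: one mult perms_comp)
qed

sublocale rgd_action_relations W S G copy_m copy_u copy_act "[]"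
proof
  fix p assume "p \<in> lists S" "p \<noteq> []" "distinct_adj p"
  then show "copy_act (word_u p) [] = []"
    using word_u_eq[of p] by (simp add: root_perm_def)
next
  fix p q assume pq: "p @ q \<in> lists S" "p \<noteq> []" "q \<noteq> []" "distinct_adj (p @ q)"
  \<comment> \<open>A linked \<open>q\<close> begins but does not end with \<open>t\<close>, so it has further letters.\<close>
  have "strict_prefix p (p @ [t]) \<and> strict_prefix (p @ [t]) (p @ q)" if "linked t (last p) q"
    using that pq(3) by (cases q; cases "tl q") (auto simp: linked_def strict_prefix_def)
  then show "word_u p \<otimes>\<^bsub>G\<^esub> word_u (p @ q) \<otimes>\<^bsub>G\<^esub> word_u p \<otimes>\<^bsub>G\<^esub> word_u (p @ q) = \<one>\<^bsub>G\<^esub> \<or>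
      (\<exists>r. strict_prefix p r \<and> strict_prefix r (p @ q) \<and>
        word_u p \<otimes>\<^bsub>G\<^esub> word_u (p @ q) \<otimes>\<^bsub>G\<^esub> word_u p \<otimes>\<^bsub>G\<^esub> word_u (p @ q) = word_u r)"
    unfolding word_u_commutator[OF pq] by auto
qed

text \<open>The words are \<open>a\<close> and \<open>a (t a)\<^sup>n\<^sup>+\<^sup>1\<close>, with commutator \<open>a t\<close> for all \<open>n\<close>.\<close>

lemma not_FPRS_copy:
  assumes a: "a \<in> S" "a \<noteq> t"
  shows "\<not> FPRS W S G U"
proof (rule not_FPRS[where p = "[a]" and r = "[a, t]"])
  define q where "q n = concat (replicate (Suc n) [t, a])" for n
  have q: "q n \<in> lists S" "distinct_adj (a # q n)" "n \<le> length (q n)" "hd (q n) = t" "last (q n) = a"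
      "q n \<noteq> []" for n
  proof (induction n)
    case (Suc n)
    have "q (Suc n) = t # a # q n" by (simp add: q_def)
    then show "q (Suc n) \<in> lists S" "distinct_adj (a # q (Suc n))" "Suc n \<le> length (q (Suc n))"
      "hd (q (Suc n)) = t" "last (q (Suc n)) = a" "q (Suc n) \<noteq> []"
      using Suc a t by auto
  qed (use a t in \<open>auto simp: q_def\<close>)
  fix n
  show "word_u [a] \<otimes>\<^bsub>G\<^esub> word_u (a # q n) \<otimes>\<^bsub>G\<^esub> word_u [a] \<otimes>\<^bsub>G\<^esub> word_u (a # q n) = word_u [a, t]"
    using word_u_commutator[of "[a]" "q n"] q[of n] a by (simp add: linked_def)
  show "a # q n \<in> lists S" "a # q n \<noteq> []" "distinct_adj (a # q n)" "n \<le> length (a # q n)"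
    using q[of n] a by simp_all
qed (use a t in auto)

end

theorem corollary2:
  fixes W :: "('a, 'b) monoid_scheme" and S :: "'a set"
  assumes "universal_coxeter_system W S"
    and "finite S"
    and "card S \<ge> 2"
  shows "\<exists>(G :: nat monoid) (U :: 'a set \<Rightarrow> nat set).
           RGD_system W S G U \<and> over_F2 W S U \<and> \<not> FPRS W S G U"
proof -
  interpret universal_coxeter W S by unfold_locales (rule assms(1))
  obtain a t where at: "a \<in> S" "t \<in> S" "a \<noteq> t"
    using assms(2,3) by (metis card_le_Suc0_iff_eq not_less_eq_eq numeral_2_eq_2)
  obtain G :: "nat monoid" and e where G: "group G" "inj_on e (perms S t)" "carrier G = e ` perms S t"
      "\<one>\<^bsub>G\<^esub> = e id"
      "\<And>f g. f \<in> perms S t \<Longrightarrow> g \<in> perms S t \<Longrightarrow> e f \<otimes>\<^bsub>G\<^esub> e g = e (f \<circ> g)"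
    using nat_group_of_permutations[OF countable_perms[OF assms(2)] perms_id perms_comp perms_inverse]
    by metis
  interpret perms_copy W S G t e
    using at(2) G by (simp add: perms_copy_def perms_copy_axioms_def universal_coxeter_axioms)
  show ?thesis using RGD_system over_F2 not_FPRS_copy[OF at(1,3)] by blast
qed

end
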